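(* Let $\mathcal{H}$ be a complex Hilbert space, let $r$ be a positive rational number such that $r>1$, and let $\phi:\mathcal{S}(\mathcal{H})\to\mathcal{S}(\mathcal{H})$ be a surjective function (not assumed linear or continuous) which satisfies $$\sigma\big(|A|^r B\big)=\sigma\big(|\phi(A)|^r\phi(B)\big)$$ for all $A\in\mathcal{P}_1(\mathcal{H})\cup\{I\}$ and all $B\in\mathcal{S}(\mathcal{H})$. Then there exists a bounded linear or conjugate linear bijection $T:\mathcal{H}\to\mathcal{H}$ satisfying $T^*=T^{-1}$ such that $$\phi(A)=TAT^*\quad\text{for all }A\in\mathcal{S}(\mathcal{H}).$$
   Context: $\mathcal{S}(\mathcal{H})$ is the set of all bounded self-adjoint operators on $\mathcal{H}$, $\mathcal{P}_1(\mathcal{H})$ is the set of all rank-one (orthogonal) projections on $\mathcal{H}$, $I$ is the identity operator, $\sigma(A)$ is the spectrum of the bounded operator $A$ on $\mathcal{H}$, and $|A|=(A^*A)^{1/2}$. For a positive rational number $r$, $|A|^r$ is defined by the continuous functional calculus. For a conjugate linear bounded $T$, the adjoint $T^*$ is the conjugate linear map determined by $\langle Tx,y\rangle=\langle T^*y,x\rangle$ for all $x,y$; thus the conclusion says that $T$ is unitary or antiunitary. *)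

theory Defs
  imports "HOL-Analysis.Analysis" "HOL-Computational_Algebra.Polynomial"
begin

class scaleC =
  fixes scaleC :: "complex \<Rightarrow> 'a \<Rightarrow> 'a" (infixr \<open>*\<^sub>C\<close> 75)

text \<open>Complex Hilbert spaces, of arbitrary (possibly zero) dimension; completeness is part of
  \<open>banach\<close>. The inner product is linear in the first argument, and the last axiom
  says both that it is positive definite and that it induces the norm.\<close>

class complex_hilbert = banach + scaleC +
  fixes cinner :: "'a \<Rightarrow> 'a \<Rightarrow> complex"
  assumes scaleC_add_right: "c *\<^sub>C (x + y) = c *\<^sub>C x + c *\<^sub>C y"
    and scaleC_add_left: "(c + d) *\<^sub>C x = c *\<^sub>C x + d *\<^sub>C x"
    and scaleC_scaleC: "c *\<^sub>C d *\<^sub>C x = (c * d) *\<^sub>C x"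
    and scaleR_scaleC: "r *\<^sub>R x = complex_of_real r *\<^sub>C x"
    and cinner_commute: "cinner x y = cnj (cinner y x)"
    and cinner_add_left: "cinner (x + y) z = cinner x z + cinner y z"
    and cinner_scaleC_left: "cinner (c *\<^sub>C x) y = c * cinner x y"
    and cinner_self: "cinner x x = complex_of_real ((norm x)\<^sup>2)"

instantiation complex :: complex_hilbert
begin

definition scaleC_complex :: "complex \<Rightarrow> complex \<Rightarrow> complex" where
  "scaleC_complex c x = c * x"

definition cinner_complex :: "complex \<Rightarrow> complex \<Rightarrow> complex" where
  "cinner_complex x y = x * cnj y"

instance
proof
  show "cinner x x = complex_of_real ((norm x)\<^sup>2)" for x :: complex
    by (simp only: cinner_complex_def complex_norm_square)
qed (simp_all add: scaleC_complex_def cinner_complex_def distrib_left distrib_right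
    scaleR_conv_of_real mult.commute)

end

lemma norm_scaleC: "norm (c *\<^sub>C x) = cmod c * norm (x :: 'a :: complex_hilbert)"
proof -
  have "cinner x (c *\<^sub>C x) = cnj c * cinner x x"
    by (subst cinner_commute) (simp add: cinner_scaleC_left cinner_self)
  then have "complex_of_real ((norm (c *\<^sub>C x))\<^sup>2) = (c * cnj c) * complex_of_real ((norm x)\<^sup>2)"
    by (simp only: cinner_scaleC_left mult.assoc flip: cinner_self)
  also have "\<dots> = complex_of_real ((cmod c * norm x)\<^sup>2)"
    by (simp only: complex_norm_square[symmetric] power_mult_distrib of_real_power of_real_mult)
  finally have "(norm (c *\<^sub>C x))\<^sup>2 = (cmod c * norm x)\<^sup>2"
    by (simp only: of_real_eq_iff)
  then show ?thesis
    by (rule power2_eq_imp_eq) simp_all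
qed

lemma bounded_linear_scaleC: "bounded_linear (\<lambda>x :: 'a :: complex_hilbert. c *\<^sub>C x)"
proof (rule bounded_linear_intro)
  show "c *\<^sub>C (r *\<^sub>R x) = r *\<^sub>R (c *\<^sub>C x)" for r and x :: 'a
    by (simp add: scaleR_scaleC scaleC_scaleC mult.commute)
  show "norm (c *\<^sub>C x) \<le> norm x * cmod c" for x :: 'a
    by (simp add: norm_scaleC mult.commute)
qed (rule scaleC_add_right)

text \<open>The type \<open>'a \<Rightarrow>\<^sub>L 'a\<close> contains all bounded real-linear maps; the bounded
  (complex-)linear and conjugate linear operators are carved out by predicates.\<close>

definition clinear_op :: "('a :: complex_hilbert \<Rightarrow>\<^sub>L 'a) \<Rightarrow> bool" where
  "clinear_op A \<longleftrightarrow> (\<forall>c x. A (c *\<^sub>C x) = c *\<^sub>C A x)"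

definition conjlinear_op :: "('a :: complex_hilbert \<Rightarrow>\<^sub>L 'a) \<Rightarrow> bool" where
  "conjlinear_op A \<longleftrightarrow> (\<forall>c x. A (c *\<^sub>C x) = cnj c *\<^sub>C A x)"

lift_definition scalar_op :: "complex \<Rightarrow> 'a :: complex_hilbert \<Rightarrow>\<^sub>L 'a" is "\<lambda>c x. c *\<^sub>C x"
  by (rule bounded_linear_scaleC)

text \<open>Adjoints of linear and of conjugate linear operators. The defining identity determines
  the adjoint uniquely and makes it again linear, respectively conjugate linear.\<close>

definition op_adjoint :: "('a :: complex_hilbert \<Rightarrow>\<^sub>L 'a) \<Rightarrow> ('a \<Rightarrow>\<^sub>L 'a)" where
  "op_adjoint A = (THE B :: 'a \<Rightarrow>\<^sub>L 'a. \<forall>x y. cinner (A x) y = cinner x (B y))"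

definition conj_adjoint :: "('a :: complex_hilbert \<Rightarrow>\<^sub>L 'a) \<Rightarrow> ('a \<Rightarrow>\<^sub>L 'a)" where
  "conj_adjoint T = (THE B :: 'a \<Rightarrow>\<^sub>L 'a. \<forall>x y. cinner (T x) y = cinner (B y) x)"

definition selfadjoint_ops :: "('a :: complex_hilbert \<Rightarrow>\<^sub>L 'a) set" where
  "selfadjoint_ops = {A. clinear_op A \<and> (\<forall>x y. cinner (A x) y = cinner x (A y))}"

definition rank_one_projections :: "('a :: complex_hilbert \<Rightarrow>\<^sub>L 'a) set" where
  "rank_one_projections = {P \<in> selfadjoint_ops. P o\<^sub>L P = P \<and>
     (\<exists>e. e \<noteq> 0 \<and> range (blinfun_apply P) = range (\<lambda>c. c *\<^sub>C e))}"

definition op_spectrum :: "('a :: complex_hilbert \<Rightarrow>\<^sub>L 'a) \<Rightarrow> complex set" where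
  "op_spectrum A = {z. \<not> (\<exists>B. clinear_op B \<and>
     B o\<^sub>L (A - scalar_op z) = id_blinfun \<and> (A - scalar_op z) o\<^sub>L B = id_blinfun)}"

definition op_poly :: "real poly \<Rightarrow> ('a :: complex_hilbert \<Rightarrow>\<^sub>L 'a) \<Rightarrow> ('a \<Rightarrow>\<^sub>L 'a)" where
  "op_poly p A = (\<Sum>i\<le>degree p. coeff p i *\<^sub>R (((o\<^sub>L) A ^^ i) id_blinfun))"

text \<open>Continuous functional calculus \<open>f(A)\<close> for a self-adjoint \<open>A\<close> and a real function \<open>f\<close>
  continuous on the spectrum of \<open>A\<close>, which is real and compact: the limit in operator norm of
  \<open>p\<^sub>n(A)\<close> for any polynomials \<open>p\<^sub>n\<close> converging to \<open>f\<close> uniformly on the spectrum.\<close>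

definition op_fun_calc ::
    "(real \<Rightarrow> real) \<Rightarrow> ('a :: complex_hilbert \<Rightarrow>\<^sub>L 'a) \<Rightarrow> ('a \<Rightarrow>\<^sub>L 'a)" where
  "op_fun_calc f A = (THE F. \<exists>p :: nat \<Rightarrow> real poly.
     uniform_limit {t. complex_of_real t \<in> op_spectrum A} (\<lambda>n. poly (p n)) f sequentially \<and>
     (\<lambda>n. op_poly (p n) A) \<longlonglongrightarrow> F)"

definition op_abs :: "('a :: complex_hilbert \<Rightarrow>\<^sub>L 'a) \<Rightarrow> ('a \<Rightarrow>\<^sub>L 'a)" where
  "op_abs A = op_fun_calc sqrt (op_adjoint A o\<^sub>L A)"

text \<open>Meant for positive \<open>A\<close> and \<open>r > 0\<close>, so that the convention \<open>0 powr r = 0\<close> is the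
  continuous one.\<close>

definition op_powr :: "('a :: complex_hilbert \<Rightarrow>\<^sub>L 'a) \<Rightarrow> real \<Rightarrow> ('a \<Rightarrow>\<^sub>L 'a)" where
  "op_powr A r = op_fun_calc (\<lambda>t. t powr r) A"

end

theory Submission
  imports Defs "HOL-Computational_Algebra.Fundamental_Theorem_Algebra"
begin

text \<open>If \<open>t\<close> is an approximate eigenvalue of \<open>J = \<phi>(I)\<close>, then \<open>|t|\<^sup>r t\<close> is one of
  \<open>|J|\<^sup>r J\<close>, whose spectrum is that of \<open>I\<close>; hence \<open>t = 1\<close> and \<open>J = I\<close>, so \<open>\<phi>\<close> preserves the
  spectrum. Then \<open>\<phi>\<close> maps the projection \<open>P\<close> onto \<open>\<complex>e\<close> to a projection, which has rank
  one because \<open>\<sigma>(PB)\<close> contains at most one nonzero number, namely \<open>\<langle>Be, e\<rangle>\<close>. Comparing these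
  numbers gives \<open>\<langle>\<phi>(B)f, f\<rangle> = \<langle>Be, e\<rangle>\<close> when \<open>\<phi>(P)\<close> projects onto the unit vector \<open>f\<close>. As every
  \<open>f\<close> occurs, quadratic forms show that \<open>\<phi>\<close> is real linear. This linearity shortens the proof of
  Wigner's theorem: for \<open>x\<close> orthogonal to \<open>e\<close>, the part of
  \<open>\<phi>((e + x) \<otimes> (e + x))\<close> that is linear in \<open>x\<close> defines a real-linear isometry \<open>U\<close> with
  \<open>\<phi>(x \<otimes> x) = Ux \<otimes> Ux\<close>, which is complex linear or conjugate linear.\<close>

section \<open>Complex inner products and operators\<close>

text \<open>\<open>op_abs A\<close> and \<open>op_powr A r\<close> are definite descriptions, so
  nothing about them is usable before the functional calculus is known to exist and to be unique.
  Both facts rest on one estimate, \<open>norm_op_poly_le\<close>: a bound of |p| on the spectrum of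
  A also bounds the norm of p(A). Existence for general operators is needed only for \<phi>(I),
  which is at first an arbitrary self-adjoint operator; a projection P satisfies |P|^r = P, so the
  exponent disappears once \<phi>(P) is known to be a projection. The obstacle in the Wigner part is
  the phase: \<open>rank_one w\<close> determines w only up to a unit scalar, and arbitrary choices
  of w need not add up. Applying the image of \<open>rank_one (e + x)\<close> to the fixed vector f
  gives <f, w> w, which does not depend on the phase of w and, for x orthogonal to e, is f plus a
  term additive in x.\<close>

lemma scaleC_of_real: "complex_of_real r *\<^sub>C x = r *\<^sub>R (x :: 'a :: complex_hilbert)"
  by (simp add: scaleR_scaleC)

lemma scaleC_one [simp]: "1 *\<^sub>C x = (x :: 'a :: complex_hilbert)"
  using scaleC_of_real[of 1 x] by simp

lemma scaleC_zero_left [simp]: "0 *\<^sub>C x = (0 :: 'a :: complex_hilbert)"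
  using scaleC_of_real[of 0 x] by simp

lemma scaleC_zero_right [simp]: "c *\<^sub>C (0 :: 'a :: complex_hilbert) = 0"
  using bounded_linear_scaleC[of c] by (rule linear_simps)

lemma scaleC_minus_right: "c *\<^sub>C (- x) = - (c *\<^sub>C (x :: 'a :: complex_hilbert))"
  using bounded_linear_scaleC[of c] by (rule linear_simps)

lemma scaleC_diff_right: "c *\<^sub>C (x - y) = c *\<^sub>C x - c *\<^sub>C (y :: 'a :: complex_hilbert)"
  using bounded_linear_scaleC[of c] by (rule linear_simps)

lemma scaleC_minus_left: "(- c) *\<^sub>C x = - (c *\<^sub>C (x :: 'a :: complex_hilbert))"
  by (rule minus_unique[symmetric]) (simp flip: scaleC_add_left)

lemma scaleC_diff_left: "(c - d) *\<^sub>C x = c *\<^sub>C x - d *\<^sub>C (x :: 'a :: complex_hilbert)"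
  using scaleC_add_left[of c "- d" x] by (simp add: scaleC_minus_left)

lemma scaleC_scaleR: "c *\<^sub>C r *\<^sub>R x = r *\<^sub>R c *\<^sub>C (x :: 'a :: complex_hilbert)"
  by (simp add: scaleR_scaleC scaleC_scaleC mult.commute)

lemma cinner_add_right: "cinner x (y + z) = cinner x y + cinner x (z :: 'a :: complex_hilbert)"
  using cinner_add_left[of y z x] by (simp add: cinner_commute[of x "y + z"] cinner_commute[of x y] cinner_commute[of x z])

lemma cinner_scaleC_right: "cinner x (c *\<^sub>C y) = cnj c * cinner x (y :: 'a :: complex_hilbert)"
  by (simp add: cinner_commute[of x "c *\<^sub>C y"] cinner_commute[of x y] cinner_scaleC_left)

lemma cinner_scaleR_left: "cinner (r *\<^sub>R x) y = of_real r * cinner x (y :: 'a :: complex_hilbert)"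
  by (simp add: scaleR_scaleC cinner_scaleC_left)

lemma cinner_scaleR_right: "cinner x (r *\<^sub>R y) = of_real r * cinner x (y :: 'a :: complex_hilbert)"
  by (simp add: scaleR_scaleC cinner_scaleC_right)

lemma cinner_zero_left [simp]: "cinner 0 (y :: 'a :: complex_hilbert) = 0"
  using cinner_scaleR_left[of 0 0 y] by simp

lemma cinner_zero_right [simp]: "cinner (y :: 'a :: complex_hilbert) 0 = 0"
  using cinner_scaleR_right[of y 0 0] by simp

lemma cinner_minus_left: "cinner (- x) y = - cinner x (y :: 'a :: complex_hilbert)"
  using cinner_scaleR_left[of "-1" x y] by simp

lemma cinner_minus_right: "cinner x (- y) = - cinner x (y :: 'a :: complex_hilbert)"
  using cinner_scaleR_right[of x "-1" y] by simp

lemma cinner_diff_left: "cinner (x - y) z = cinner x z - cinner y (z :: 'a :: complex_hilbert)"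
  using cinner_add_left[of x "- y" z] by (simp add: cinner_minus_left)

lemma cinner_diff_right: "cinner x (y - z) = cinner x y - cinner x (z :: 'a :: complex_hilbert)"
  using cinner_add_right[of x y "- z"] by (simp add: cinner_minus_right)

lemmas cinner_simps = cinner_add_left cinner_add_right cinner_diff_left cinner_diff_right
  cinner_minus_left cinner_minus_right cinner_scaleC_left cinner_scaleC_right
  cinner_scaleR_left cinner_scaleR_right

lemma Re_cinner_self: "Re (cinner x x) = (norm (x :: 'a :: complex_hilbert))\<^sup>2"
  by (simp add: cinner_self)

lemma Re_cinner_commute: "Re (cinner x y) = Re (cinner y (x :: 'a :: complex_hilbert))"
  by (subst cinner_commute) simp

lemma norm_add_sq:
  "(norm (x + y))\<^sup>2 = (norm x)\<^sup>2 + 2 * Re (cinner x y) + (norm (y :: 'a :: complex_hilbert))\<^sup>2"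
  using Re_cinner_commute[of x y] by (simp add: cinner_simps flip: Re_cinner_self)

lemma norm_diff_sq:
  "(norm (x - y))\<^sup>2 = (norm x)\<^sup>2 - 2 * Re (cinner x y) + (norm (y :: 'a :: complex_hilbert))\<^sup>2"
  using norm_add_sq[of x "- y"] by (simp add: cinner_minus_right)

text \<open>Pythagoras. It yields the Cauchy-Schwarz inequality, later its equality case, and the
  norm of the operator built from \<open>U\<close>.\<close>

lemma norm_diff_proj_sq:
  fixes x e :: "'a :: complex_hilbert"
  assumes "norm e = 1"
  shows "(norm (x - cinner x e *\<^sub>C e))\<^sup>2 = (norm x)\<^sup>2 - (cmod (cinner x e))\<^sup>2"
proof -
  have "Re (cnj (cinner x e) * cinner x e) = (cmod (cinner x e))\<^sup>2"
    by (simp add: cmod_power2 flip: power2_eq_square)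
  then show ?thesis
    using assms by (simp add: norm_diff_sq cinner_simps norm_scaleC)
qed

lemma cmod_cinner_le: "cmod (cinner x y) \<le> norm x * norm (y :: 'a :: complex_hilbert)"
proof (cases "y = 0")
  case False
  define e where "e = (1 / norm y) *\<^sub>R y"
  have e: "norm e = 1" and y: "y = norm y *\<^sub>R e"
    using False by (simp_all add: e_def)
  have "(cmod (cinner x e))\<^sup>2 \<le> (norm x)\<^sup>2"
    using norm_diff_proj_sq[OF e, of x] zero_le_power2[of "norm (x - cinner x e *\<^sub>C e)"] by linarith
  then have "cmod (cinner x e) \<le> norm x"
    by (rule power2_le_imp_le) simp
  then have "cmod (cinner x (norm y *\<^sub>R e)) \<le> norm x * norm y"
    by (simp add: cinner_scaleR_right norm_mult mult.commute[of "norm x"] mult_left_mono)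
  then show ?thesis
    by (simp only: y[symmetric])
qed simp

lemma bounded_bilinear_cinner:
  "bounded_bilinear (cinner :: 'a :: complex_hilbert \<Rightarrow> 'a \<Rightarrow> complex)"
proof
  show "\<exists>K. \<forall>a b :: 'a. norm (cinner a b) \<le> norm a * norm b * K"
    by (rule exI[of _ 1]) (simp add: cmod_cinner_le)
qed (simp_all add: cinner_simps scaleR_conv_of_real)

lemma cinner_left_eqI:
  fixes x y :: "'a :: complex_hilbert"
  assumes "\<And>z. cinner x z = cinner y z"
  shows "x = y"
proof -
  have "cinner (x - y) (x - y) = 0"
    unfolding cinner_diff_left by (simp add: assms)
  then show ?thesis
    by (simp add: cinner_self)
qed

lemma cinner_right_eqI:
  fixes x y :: "'a :: complex_hilbert"
  assumes "\<And>z. cinner z x = cinner z y"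
  shows "x = y"
proof (rule cinner_left_eqI)
  show "cinner x z = cinner y z" for z
    unfolding cinner_commute[of x z] cinner_commute[of y z] by (simp add: assms)
qed

section \<open>Complex linear and self-adjoint operators\<close>

lemma clinear_opD: "clinear_op A \<Longrightarrow> A (c *\<^sub>C x) = c *\<^sub>C A x"
  by (simp add: clinear_op_def)

lemma apply_scalar_op [simp]: "scalar_op c x = c *\<^sub>C x"
  by transfer simp

lemma scalar_op_of_real: "scalar_op (complex_of_real r) = r *\<^sub>R id_blinfun"
  by (rule blinfun_eqI) (simp add: scaleC_of_real blinfun.scaleR_left)

lemma clinear_op_zero [simp]: "clinear_op 0"
  by (simp add: clinear_op_def)

lemma clinear_op_id [simp]: "clinear_op id_blinfun"
  by (simp add: clinear_op_def)

lemma clinear_op_scalar [simp]: "clinear_op (scalar_op c)"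
  by (simp add: clinear_op_def scaleC_scaleC mult.commute)

lemma clinear_op_add: "clinear_op A \<Longrightarrow> clinear_op B \<Longrightarrow> clinear_op (A + B)"
  by (simp add: clinear_op_def blinfun.add_left scaleC_add_right)

lemma clinear_op_diff: "clinear_op A \<Longrightarrow> clinear_op B \<Longrightarrow> clinear_op (A - B)"
  by (simp add: clinear_op_def blinfun.diff_left scaleC_diff_right)

lemma clinear_op_scaleR: "clinear_op A \<Longrightarrow> clinear_op (r *\<^sub>R A)"
  by (simp add: clinear_op_def blinfun.scaleR_left scaleC_scaleR)

lemma clinear_op_compose: "clinear_op A \<Longrightarrow> clinear_op B \<Longrightarrow> clinear_op (A o\<^sub>L B)"
  by (simp add: clinear_op_def)

lemma selfadjointD: "A \<in> selfadjoint_ops \<Longrightarrow> cinner (A x) y = cinner x (A y)"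
  by (simp add: selfadjoint_ops_def)

lemma selfadjoint_clinear: "A \<in> selfadjoint_ops \<Longrightarrow> clinear_op A"
  by (simp add: selfadjoint_ops_def)

lemma selfadjoint_zero [simp]: "0 \<in> selfadjoint_ops"
  by (simp add: selfadjoint_ops_def)

lemma selfadjoint_id [simp]: "id_blinfun \<in> selfadjoint_ops"
  by (simp add: selfadjoint_ops_def)

lemma selfadjoint_add:
  "A \<in> selfadjoint_ops \<Longrightarrow> B \<in> selfadjoint_ops \<Longrightarrow> A + B \<in> selfadjoint_ops"
  by (simp add: selfadjoint_ops_def clinear_op_add blinfun.add_left cinner_simps)

lemma selfadjoint_diff:
  "A \<in> selfadjoint_ops \<Longrightarrow> B \<in> selfadjoint_ops \<Longrightarrow> A - B \<in> selfadjoint_ops"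
  by (simp add: selfadjoint_ops_def clinear_op_diff blinfun.diff_left cinner_simps)

lemma selfadjoint_scaleR: "A \<in> selfadjoint_ops \<Longrightarrow> r *\<^sub>R A \<in> selfadjoint_ops"
  by (simp add: selfadjoint_ops_def clinear_op_scaleR blinfun.scaleR_left cinner_simps)

lemma selfadjoint_compose:
  assumes A: "A \<in> selfadjoint_ops" and B: "B \<in> selfadjoint_ops" and AB: "A o\<^sub>L B = B o\<^sub>L A"
  shows "A o\<^sub>L B \<in> selfadjoint_ops"
proof -
  have "A (B y) = B (A y)" for y
    using AB by (metis blinfun_apply_blinfun_compose)
  then show ?thesis
    by (simp add: selfadjoint_ops_def clinear_op_compose selfadjoint_clinear[OF A]
        selfadjoint_clinear[OF B] selfadjointD[OF A] selfadjointD[OF B])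
qed

lemma op_adjoint_eqI:
  fixes A B :: "'a :: complex_hilbert \<Rightarrow>\<^sub>L 'a"
  assumes "\<And>x y. cinner (A x) y = cinner x (B y)"
  shows "op_adjoint A = B"
  unfolding op_adjoint_def
proof (rule the_equality)
  show "C = B" if "\<forall>x y. cinner (A x) y = cinner x (C y)"
    for C :: "'a \<Rightarrow>\<^sub>L 'a"
    by (rule blinfun_eqI, rule cinner_right_eqI) (rule trans[OF that[rule_format, symmetric] assms])
qed (intro allI assms)

lemma conj_adjoint_eqI:
  fixes A B :: "'a :: complex_hilbert \<Rightarrow>\<^sub>L 'a"
  assumes "\<And>x y. cinner (A x) y = cinner (B y) x"
  shows "conj_adjoint A = B"
  unfolding conj_adjoint_def
proof (rule the_equality)
  show "C = B" if "\<forall>x y. cinner (A x) y = cinner (C y) x"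
    for C :: "'a \<Rightarrow>\<^sub>L 'a"
    by (rule blinfun_eqI, rule cinner_left_eqI) (rule trans[OF that[rule_format, symmetric] assms])
qed (intro allI assms)

lemma Im_cinner_selfadjoint:
  assumes "A \<in> selfadjoint_ops"
  shows "Im (cinner (A x) x) = 0"
proof -
  have "cinner (A x) x = cnj (cinner (A x) x)"
    using selfadjointD[OF assms, of x x] cinner_commute[of x "A x"] by simp
  then show ?thesis
    by (simp add: complex_eq_iff)
qed

text \<open>Polarization: expanding the form at x + y kills Re <Ax, y>, and y = Ax then gives Ax =
  0.\<close>

lemma selfadjoint_eq_0I:
  assumes A: "A \<in> selfadjoint_ops" and 0: "\<And>x. Re (cinner (A x) x) = 0"
  shows "A = 0"
proof -
  have "Re (cinner (A x) y) = 0" for x y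
    using 0[of "x + y"] 0[of x] 0[of y] selfadjointD[OF A, of y x] Re_cinner_commute[of y "A x"]
    by (simp add: blinfun.add_right cinner_simps)
  from this[of x "A x" for x] show ?thesis
    by (intro blinfun_eqI) (simp add: Re_cinner_self)
qed

lemma selfadjoint_eqI:
  assumes "A \<in> selfadjoint_ops" "B \<in> selfadjoint_ops"
    and "\<And>x. norm x = 1 \<Longrightarrow> Re (cinner (A x) x) = Re (cinner (B x) x)"
  shows "A = B"
proof -
  have "Re (cinner ((A - B) x) x) = 0" for x
  proof (cases "x = 0")
    case False
    define e where "e = (1 / norm x) *\<^sub>R x"
    have "norm e = 1" and x: "x = norm x *\<^sub>R e"
      using False by (simp_all add: e_def)
    then have "Re (cinner ((A - B) e) e) = 0"
      using assms(3) by (simp add: blinfun.diff_left cinner_simps)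
    then have "Re (cinner ((A - B) (norm x *\<^sub>R e)) (norm x *\<^sub>R e)) = 0"
      by (simp add: blinfun.scaleR_right cinner_simps)
    then show ?thesis
      by (simp only: x[symmetric])
  qed simp
  then have "A - B = 0"
    using assms by (intro selfadjoint_eq_0I selfadjoint_diff)
  then show ?thesis
    by simp
qed

section \<open>Spectrum of self-adjoint operators\<close>

definition invertible_op :: "('a :: complex_hilbert \<Rightarrow>\<^sub>L 'a) \<Rightarrow> bool" where
  "invertible_op A \<longleftrightarrow> (\<exists>B. clinear_op B \<and> B o\<^sub>L A = id_blinfun \<and> A o\<^sub>L B = id_blinfun)"

lemma op_spectrum_iff: "z \<in> op_spectrum A \<longleftrightarrow> \<not> invertible_op (A - scalar_op z)"
  by (simp add: op_spectrum_def invertible_op_def)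

text \<open>A stand-in for invertibility that passes to products without commutation; for
  self-adjoint operators the two agree.\<close>

definition bounded_below :: "('a :: complex_hilbert \<Rightarrow>\<^sub>L 'a) \<Rightarrow> bool" where
  "bounded_below A \<longleftrightarrow> (\<exists>c>0. \<forall>x. c * norm x \<le> norm (A x))"

lemma invertible_op_bounded_below:
  assumes "invertible_op A"
  shows "bounded_below A"
proof -
  obtain B where B: "B o\<^sub>L A = id_blinfun"
    using assms by (auto simp: invertible_op_def)
  define c where "c = 1 / (norm B + 1)"
  have "c * norm x \<le> norm (A x)" for x
  proof -
    have "norm x = norm (B (A x))"
      using B by (metis blinfun_apply_blinfun_compose blinfun_apply_id_blinfun id_apply)
    also have "\<dots> \<le> norm B * norm (A x)"
      by (rule norm_blinfun)
    also have "\<dots> \<le> (norm B + 1) * norm (A x)"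
      by (simp add: mult_right_mono)
    finally show ?thesis
      by (simp add: c_def field_simps add_pos_nonneg add_nonneg_pos)
  qed
  moreover have "c > 0"
    by (simp add: c_def add_nonneg_pos)
  ultimately show ?thesis
    by (auto simp: bounded_below_def)
qed

lemma bounded_below_compose:
  assumes "bounded_below A" "bounded_below B"
  shows "bounded_below (A o\<^sub>L B)"
proof -
  obtain a b where ab: "a > 0" "b > 0" "\<And>x. a * norm x \<le> norm (A x)" "\<And>x. b * norm x \<le> norm (B x)"
    using assms by (auto simp: bounded_below_def)
  have "a * b * norm x \<le> norm (A (B x))" for x
    using order_trans[OF mult_left_mono[OF ab(4)[of x], of a] ab(3)[of "B x"]] ab(1)
    by (simp add: mult.assoc)
  then show ?thesis
    using ab by (auto simp: bounded_below_def intro!: exI[of _ "a * b"])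
qed

text \<open>Surjectivity: \<open>x \<mapsto> x - (A\<^sup>2 x - y) / M\<^sup>2\<close> is a contraction, because
  \<open>\<parallel>x - A\<^sup>2 x / M\<^sup>2\<parallel>\<^sup>2 \<le> \<parallel>x\<parallel>\<^sup>2 - \<parallel>A x\<parallel>\<^sup>2 / M\<^sup>2\<close> whenever \<open>\<parallel>A\<parallel> \<le> M\<close>.\<close>

lemma selfadjoint_bounded_below_surj:
  assumes A: "A \<in> selfadjoint_ops" and c: "c > 0" "\<And>x. c * norm x \<le> norm (A x)"
  shows "surj (blinfun_apply A)"
proof -
  \<comment> \<open>The summand c ensures M > 0 and c <= M, so that 1 - c^2/M^2 lies in [0,
    1).\<close>
  define M where "M = norm A + c"
  have M: "M > 0" "c \<le> M" "norm A \<le> M"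
    using c(1) by (simp_all add: M_def add_nonneg_pos)
  define k where "k = sqrt (1 - c\<^sup>2 / M\<^sup>2)"
  have cM: "0 < c\<^sup>2 / M\<^sup>2" "c\<^sup>2 / M\<^sup>2 \<le> 1"
    using M c(1) by (simp_all add: power_mono divide_le_eq_1)
  then have k: "0 \<le> k" "k < 1"
    by (simp_all add: k_def)
  have contr: "norm (x - (1 / M\<^sup>2) *\<^sub>R A (A x)) \<le> k * norm x" for x
  proof -
    have "Re (cinner x (A (A x))) = (norm (A x))\<^sup>2"
      unfolding selfadjointD[OF A, of x "A x", symmetric] by (rule Re_cinner_self)
    moreover have "(norm (A (A x)))\<^sup>2 \<le> M\<^sup>2 * (norm (A x))\<^sup>2"
      using order_trans[OF norm_blinfun mult_right_mono[OF M(3)]]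
      by (simp add: power_mono flip: power_mult_distrib)
    then have "(norm (A (A x)))\<^sup>2 / M\<^sup>2 \<le> (norm (A x))\<^sup>2"
      using M by (simp add: field_simps)
    then have "(norm (A (A x)))\<^sup>2 / M\<^sup>2 / M\<^sup>2 \<le> (norm (A x))\<^sup>2 / M\<^sup>2"
      by (rule divide_right_mono) simp
    ultimately have "(norm (x - (1 / M\<^sup>2) *\<^sub>R A (A x)))\<^sup>2 \<le> (norm x)\<^sup>2 - (norm (A x))\<^sup>2 / M\<^sup>2"
      by (simp add: norm_diff_sq cinner_simps power_mult_distrib power_divide)
    also have "c\<^sup>2 * (norm x)\<^sup>2 \<le> (norm (A x))\<^sup>2"
      using power_mono[OF c(2)[of x], of 2] c(1) by (simp add: power_mult_distrib)
    then have "c\<^sup>2 * (norm x)\<^sup>2 / M\<^sup>2 \<le> (norm (A x))\<^sup>2 / M\<^sup>2"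
      by (rule divide_right_mono) simp
    then have "(norm x)\<^sup>2 - (norm (A x))\<^sup>2 / M\<^sup>2 \<le> (1 - c\<^sup>2 / M\<^sup>2) * (norm x)\<^sup>2"
      by (simp add: algebra_simps)
    also have "\<dots> = (k * norm x)\<^sup>2"
      using cM by (simp add: k_def power_mult_distrib)
    finally show ?thesis
      by (rule power2_le_imp_le) (simp add: k)
  qed
  show ?thesis
  proof (rule surjI)
    fix y
    define g where "g x = x - (1 / M\<^sup>2) *\<^sub>R (A (A x) - y)" for x
    have "dist (g u) (g v) \<le> k * dist u v" for u v
    proof -
      have "g u - g v = (u - v) - (1 / M\<^sup>2) *\<^sub>R A (A (u - v))"
        by (simp add: g_def blinfun.diff_right algebra_simps)
      then show ?thesis
        using contr[of "u - v"] by (simp add: dist_norm)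
    qed
    then obtain x where "g x = x"
      using banach_fix_type[OF k, of g] by auto
    then have "A (A x) = y"
      using M by (simp add: g_def)
    then show "A (inv (blinfun_apply A) y) = y"
      by (intro f_inv_into_f) auto
  qed
qed

text \<open>The lower bound gives injectivity and bounds the inverse by 1/c; surjectivity comes from
  the contraction argument.\<close>

lemma selfadjoint_bounded_below_invertible:
  assumes A: "A \<in> selfadjoint_ops" and bb: "bounded_below A"
  shows "invertible_op A"
proof -
  obtain c where c: "c > 0" "\<And>x. c * norm x \<le> norm (A x)"
    using bb by (auto simp: bounded_below_def)
  have surj: "surj (blinfun_apply A)"
    by (rule selfadjoint_bounded_below_surj[OF A c])
  have inj: "inj (blinfun_apply A)"
  proof (rule injI)
    fix x y assume "A x = A y"
    then show "x = y"
      using c(2)[of "x - y"] c(1) by (simp add: blinfun.diff_right mult_le_0_iff)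
  qed
  let ?B = "inv (blinfun_apply A)"
  have AB: "A (?B y) = y" for y
    by (simp add: surj surj_f_inv_f)
  have BA: "?B (A x) = x" for x
    by (simp add: inj)
  have bl: "bounded_linear ?B"
  proof (rule bounded_linear_intro)
    show "?B (x + y) = ?B x + ?B y" for x y
      by (rule injD[OF inj]) (simp add: AB blinfun.add_right)
    show "?B (s *\<^sub>R x) = s *\<^sub>R ?B x" for s x
      by (rule injD[OF inj]) (simp add: AB blinfun.scaleR_right)
    show "norm (?B x) \<le> norm x * (1 / c)" for x
      using c(2)[of "?B x"] c(1) by (simp add: AB field_simps)
  qed
  have "clinear_op (Blinfun ?B)"
    unfolding clinear_op_def bounded_linear_Blinfun_apply[OF bl]
    by (rule allI, rule allI, rule injD[OF inj]) (simp add: AB clinear_opD[OF selfadjoint_clinear[OF A]])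
  moreover have "Blinfun ?B o\<^sub>L A = id_blinfun" "A o\<^sub>L Blinfun ?B = id_blinfun"
    by (rule blinfun_eqI, simp add: bounded_linear_Blinfun_apply[OF bl] AB BA)+
  ultimately show ?thesis
    by (auto simp: invertible_op_def)
qed

lemma selfadjoint_scalar_op_of_real: "scalar_op (complex_of_real t) \<in> selfadjoint_ops"
  by (simp add: scalar_op_of_real selfadjoint_scaleR)

text \<open>As <Ax, x> is real, the imaginary part of <(A - z)x, x> is -Im z |x|^2; Cauchy-Schwarz
  turns this into a lower bound.\<close>

lemma selfadjoint_nonreal_bounded_below:
  assumes A: "A \<in> selfadjoint_ops" and z: "Im z \<noteq> 0"
  shows "bounded_below (A - scalar_op z)"
proof -
  have "\<bar>Im z\<bar> * norm x \<le> norm ((A - scalar_op z) x)" for x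
  proof (cases "x = 0")
    case False
    have "Im (cinner ((A - scalar_op z) x) x) = - (Im z * (norm x)\<^sup>2)"
      by (simp add: blinfun.diff_left cinner_simps Im_cinner_selfadjoint[OF A] cinner_self)
    then have "\<bar>Im z\<bar> * (norm x)\<^sup>2 \<le> cmod (cinner ((A - scalar_op z) x) x)"
      using abs_Im_le_cmod[of "cinner ((A - scalar_op z) x) x"] by (simp add: abs_mult)
    also have "\<dots> \<le> norm ((A - scalar_op z) x) * norm x"
      by (rule cmod_cinner_le)
    finally show ?thesis
      using False by (simp add: power2_eq_square)
  qed simp
  then show ?thesis
    using z by (auto simp: bounded_below_def intro!: exI[of _ "\<bar>Im z\<bar>"])
qed

lemma selfadjoint_not_bounded_belowD:
  assumes A: "A \<in> selfadjoint_ops" and z: "\<not> bounded_below (A - scalar_op z)"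
  obtains t where "z = complex_of_real t" "complex_of_real t \<in> op_spectrum A"
proof -
  have "Im z = 0"
    using selfadjoint_nonreal_bounded_below[OF A] z by blast
  then have "z = complex_of_real (Re z)"
    by (simp add: complex_eq_iff)
  moreover have "z \<in> op_spectrum A"
    using invertible_op_bounded_below z by (auto simp: op_spectrum_iff)
  ultimately show ?thesis
    using that[of "Re z"] by simp
qed

text \<open>Replaces eigenvectors, which a spectral point need not have. The sequence is an explicit
  argument because the same x must serve A and all functions of A.\<close>

definition approx_eigen :: "('a :: complex_hilbert \<Rightarrow>\<^sub>L 'a) \<Rightarrow> real \<Rightarrow> (nat \<Rightarrow> 'a) \<Rightarrow> bool" where
  "approx_eigen A t x \<longleftrightarrow> (\<forall>n. norm (x n) = 1) \<and> (\<lambda>n. A (x n) - t *\<^sub>R x n) \<longlonglongrightarrow> 0"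

text \<open>A - t is self-adjoint and not invertible, hence not bounded below; the failure of the
  lower bound 1/(n+1) supplies x n.\<close>

lemma spectrum_approx_eigen:
  assumes A: "A \<in> selfadjoint_ops" and t: "complex_of_real t \<in> op_spectrum A"
  obtains x where "approx_eigen A t x"
proof -
  let ?D = "A - scalar_op (complex_of_real t)"
  have D: "?D x = A x - t *\<^sub>R x" for x
    by (simp add: blinfun.diff_left scaleC_of_real)
  have nbb: "\<not> bounded_below ?D"
    using selfadjoint_bounded_below_invertible[OF selfadjoint_diff[OF A selfadjoint_scalar_op_of_real]] t
    by (auto simp: op_spectrum_iff)
  have "\<exists>x. norm x = 1 \<and> norm (?D x) < inverse (real (Suc n))" for n
  proof -
    obtain y where y: "norm (?D y) < inverse (real (Suc n)) * norm y"
      using nbb by (fastforce simp: bounded_below_def not_le dest: spec[of _ "inverse (real (Suc n))"])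
    then have "y \<noteq> 0"
      by auto
    then show ?thesis
      using y by (intro exI[of _ "(1 / norm y) *\<^sub>R y"])
        (simp add: blinfun.scaleR_right pos_divide_less_eq mult.commute)
  qed
  then obtain x where x: "\<And>n. norm (x n) = 1" "\<And>n. norm (?D (x n)) < inverse (real (Suc n))"
    by metis
  have "(\<lambda>n. A (x n) - t *\<^sub>R x n) \<longlonglongrightarrow> 0"
    by (rule Lim_null_comparison[OF _ LIMSEQ_inverse_real_of_nat])
      (use x(2) in \<open>auto simp: D intro!: always_eventually less_imp_le\<close>)
  then show ?thesis
    using x(1) that by (auto simp: approx_eigen_def)
qed

lemma approx_eigen_spectrum:
  assumes "approx_eigen A t x"
  shows "complex_of_real t \<in> op_spectrum A"
proof (rule ccontr)
  let ?D = "A - scalar_op (complex_of_real t)"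
  assume "complex_of_real t \<notin> op_spectrum A"
  then have "bounded_below ?D"
    using invertible_op_bounded_below by (auto simp: op_spectrum_iff)
  then obtain c where c: "c > 0" "\<And>y. c * norm y \<le> norm (?D y)"
    by (auto simp: bounded_below_def)
  have "(\<lambda>n. norm (A (x n) - t *\<^sub>R x n)) \<longlonglongrightarrow> 0"
    using assms by (simp add: approx_eigen_def tendsto_norm_zero)
  moreover have "c \<le> norm (A (x n) - t *\<^sub>R x n)" for n
    using c(2)[of "x n"] assms by (simp add: approx_eigen_def blinfun.diff_left scaleC_of_real)
  ultimately have "c \<le> 0"
    by (meson LIMSEQ_le_const)
  then show False
    using c(1) by simp
qed

lemma approx_eigen_le_norm:
  assumes "approx_eigen A t x"
  shows "\<bar>t\<bar> \<le> norm A"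
proof -
  have "(\<lambda>n. norm A + norm (A (x n) - t *\<^sub>R x n)) \<longlonglongrightarrow> norm A + norm (0 :: 'a)"
    using assms by (intro tendsto_intros) (simp add: approx_eigen_def)
  moreover have "\<bar>t\<bar> \<le> norm A + norm (A (x n) - t *\<^sub>R x n)" for n
    using norm_blinfun[of A "x n"] norm_triangle_ineq4[of "A (x n)" "A (x n) - t *\<^sub>R x n"] assms
    by (simp add: approx_eigen_def)
  ultimately show ?thesis
    using LIMSEQ_le_const by fastforce
qed

lemma approx_eigen_nonneg:
  assumes x: "approx_eigen A t x" and pos: "\<And>x. 0 \<le> Re (cinner (A x) x)"
  shows "0 \<le> t"
proof -
  have "- norm (A (x n) - t *\<^sub>R x n) \<le> t" for n
  proof -
    have "Re (cinner (A (x n) - t *\<^sub>R x n) (x n)) = Re (cinner (A (x n)) (x n)) - t"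
      using x by (simp add: cinner_simps cinner_self approx_eigen_def)
    moreover have "\<bar>Re (cinner (A (x n) - t *\<^sub>R x n) (x n))\<bar> \<le> norm (A (x n) - t *\<^sub>R x n)"
      using cmod_cinner_le[of "A (x n) - t *\<^sub>R x n" "x n"] x
        abs_Re_le_cmod[of "cinner (A (x n) - t *\<^sub>R x n) (x n)"]
      by (simp add: approx_eigen_def)
    ultimately show ?thesis
      using pos[of "x n"] by linarith
  qed
  moreover have "(\<lambda>n. - norm (A (x n) - t *\<^sub>R x n)) \<longlonglongrightarrow> - norm (0 :: 'a)"
    using x by (intro tendsto_intros) (simp add: approx_eigen_def)
  ultimately show ?thesis
    using LIMSEQ_le_const2 by fastforce
qed

section \<open>Polynomials in a self-adjoint operator\<close>

text \<open>Complex coefficients allow splitting into linear factors; \<open>op_poly\<close> is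
  embedded here by \<open>op_poly_eq_cpoly_op\<close>.\<close>

definition cpoly_op :: "complex poly \<Rightarrow> ('a :: complex_hilbert \<Rightarrow>\<^sub>L 'a) \<Rightarrow> ('a \<Rightarrow>\<^sub>L 'a)" where
  "cpoly_op p A = fold_coeffs (\<lambda>a B. scalar_op a + (A o\<^sub>L B)) p 0"

lemma scalar_op_zero [simp]: "scalar_op 0 = 0"
  by (rule blinfun_eqI) simp

lemma scalar_op_add: "scalar_op (a + b) = scalar_op a + scalar_op b"
  by (rule blinfun_eqI) (simp add: blinfun.add_left scaleC_add_left)

lemma cpoly_op_0 [simp]: "cpoly_op 0 A = 0"
  by (simp add: cpoly_op_def)

lemma cpoly_op_pCons [simp]: "cpoly_op (pCons a p) A = scalar_op a + (A o\<^sub>L cpoly_op p A)"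
  by (cases "a = 0 \<and> p = 0") (auto simp: cpoly_op_def)

lemma cpoly_op_add: "cpoly_op (p + q) A = cpoly_op p A + cpoly_op q A"
  by (induction p q rule: poly_induct2) (simp_all add: scalar_op_add
      bounded_bilinear.add_right[OF bounded_bilinear_blinfun_compose])

lemma cpoly_op_smult:
  assumes "clinear_op A"
  shows "cpoly_op (smult c p) A = scalar_op c o\<^sub>L cpoly_op p A"
  by (induction p; rule blinfun_eqI)
    (simp_all add: blinfun.add_left scaleC_add_right scaleC_scaleC clinear_opD[OF assms])

lemma cpoly_op_mult:
  assumes "clinear_op A"
  shows "cpoly_op (p * q) A = cpoly_op p A o\<^sub>L cpoly_op q A"
proof (induction p)
  case (pCons a p)
  then show ?case
    by (intro blinfun_eqI) (simp add: cpoly_op_add cpoly_op_smult[OF assms] blinfun.add_left)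
qed simp

text \<open>One half of spectral mapping: split off a root z. Either z is not real or it is a real
  point outside the spectrum; in both cases A - z is bounded below, and so is the product.\<close>

lemma cpoly_op_bounded_below:
  assumes A: "A \<in> selfadjoint_ops" and "q \<noteq> 0"
    and "\<And>t. complex_of_real t \<in> op_spectrum A \<Longrightarrow> poly q (complex_of_real t) \<noteq> 0"
  shows "bounded_below (cpoly_op q A)"
  using assms(2,3)
proof (induction "degree q" arbitrary: q)
  case 0
  then obtain a where q: "q = [:a:]"
    by (metis degree_eq_zeroE)
  with 0 show ?case
    by (auto simp: bounded_below_def norm_scaleC intro!: exI[of _ "cmod a"])
next
  case (Suc n)
  then have "\<not> constant (poly q)"
    by (simp add: constant_degree)
  then obtain z where "poly q z = 0"
    using fundamental_theorem_of_algebra by blast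
  then obtain q' where q: "q = [:- z, 1:] * q'"
    by (metis poly_eq_0_iff_dvd dvdE)
  have "q' \<noteq> 0"
    using Suc.prems(1) q by auto
  then have "degree q = Suc (degree q')"
    unfolding q by (subst degree_mult_eq) auto
  then have "bounded_below (cpoly_op q' A)"
    using \<open>q' \<noteq> 0\<close> Suc.hyps(2) Suc.prems(2) by (intro Suc.hyps(1)) (auto simp: q)
  moreover have "bounded_below (A - scalar_op z)"
  proof (rule ccontr)
    assume "\<not> bounded_below (A - scalar_op z)"
    then obtain t where "z = complex_of_real t" "complex_of_real t \<in> op_spectrum A"
      by (rule selfadjoint_not_bounded_belowD[OF A])
    then show False
      using Suc.prems(2)[of t] by (simp add: q)
  qed
  moreover have "cpoly_op [:- z, 1:] A = A - scalar_op z"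
    by (rule blinfun_eqI)
      (simp add: blinfun.add_left blinfun.diff_left scaleC_minus_left)
  ultimately show ?case
    unfolding q cpoly_op_mult[OF selfadjoint_clinear[OF A]] by (auto intro: bounded_below_compose)
qed

section \<open>Real polynomials in an operator and their norms\<close>

lemma op_poly_altdef:
  assumes "degree p \<le> n"
  shows "op_poly p A = (\<Sum>i\<le>n. coeff p i *\<^sub>R (((o\<^sub>L) A ^^ i) id_blinfun))"
  unfolding op_poly_def
  by (rule sum.mono_neutral_left) (use assms in \<open>auto simp: coeff_eq_0\<close>)

lemma op_poly_0 [simp]: "op_poly 0 A = 0"
  by (simp add: op_poly_def)

lemma op_poly_pCons [simp]: "op_poly (pCons a p) A = a *\<^sub>R id_blinfun + (A o\<^sub>L op_poly p A)"
proof -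
  have "op_poly (pCons a p) A =
      (\<Sum>i\<le>Suc (degree p). coeff (pCons a p) i *\<^sub>R (((o\<^sub>L) A ^^ i) id_blinfun))"
    by (rule op_poly_altdef) (rule degree_pCons_le)
  also have "\<dots> = a *\<^sub>R id_blinfun +
      (\<Sum>i\<le>degree p. coeff p i *\<^sub>R (A o\<^sub>L (((o\<^sub>L) A ^^ i) id_blinfun)))"
    by (subst sum.atMost_Suc_shift) simp
  also have "(\<Sum>i\<le>degree p. coeff p i *\<^sub>R (A o\<^sub>L (((o\<^sub>L) A ^^ i) id_blinfun))) = A o\<^sub>L op_poly p A"
    unfolding op_poly_def
    by (simp add: bounded_bilinear.sum_right[OF bounded_bilinear_blinfun_compose]
        bounded_bilinear.scaleR_right[OF bounded_bilinear_blinfun_compose])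
  finally show ?thesis .
qed

lemma op_poly_eq_cpoly_op: "op_poly p A = cpoly_op (map_poly complex_of_real p) A"
  by (induction p) (simp_all add: map_poly_pCons scalar_op_of_real)

lemma poly_map_poly_of_real:
  "poly (map_poly complex_of_real p) (complex_of_real t) = complex_of_real (poly p t)"
  by (induction p) (simp_all add: map_poly_pCons)

lemma op_poly_diff: "op_poly (p - q) A = op_poly p A - op_poly q A"
  by (induction p q rule: poly_induct2)
    (simp_all add: bounded_bilinear.diff_right[OF bounded_bilinear_blinfun_compose] scaleR_diff_left)

lemma op_poly_commute: "op_poly p A o\<^sub>L A = A o\<^sub>L op_poly p A"
proof (induction p)
  case (pCons a p)
  show ?case
  proof (rule blinfun_eqI)
    fix x
    have "op_poly p A (A x) = A (op_poly p A x)"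
      using pCons.IH by (metis blinfun_apply_blinfun_compose)
    then show "(op_poly (pCons a p) A o\<^sub>L A) x = (A o\<^sub>L op_poly (pCons a p) A) x"
      by (simp add: blinfun.add_left blinfun.add_right blinfun.scaleR_left blinfun.scaleR_right)
  qed
qed simp

lemma selfadjoint_op_poly: "A \<in> selfadjoint_ops \<Longrightarrow> op_poly p A \<in> selfadjoint_ops"
  by (induction p) (simp_all add: selfadjoint_add selfadjoint_scaleR selfadjoint_compose op_poly_commute)

text \<open>With \<open>N = \<parallel>A\<parallel>\<close>, one has
  \<open>\<parallel>A\<^sup>2 x - N\<^sup>2 x\<parallel>\<^sup>2 \<le> N\<^sup>2 (N\<^sup>2 \<parallel>x\<parallel>\<^sup>2 - \<parallel>A x\<parallel>\<^sup>2)\<close>, and the right-hand side is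
  small for vectors at which \<open>A\<close> almost attains its norm.\<close>

lemma selfadjoint_square_minus_norm_not_bounded_below:
  assumes A: "A \<in> selfadjoint_ops" and N: "norm A > 0"
  shows "\<not> bounded_below ((A o\<^sub>L A) - ((norm A)\<^sup>2) *\<^sub>R id_blinfun)"
proof
  define N where "N = norm A"
  have N: "N > 0"
    using assms by (simp add: N_def)
  assume "bounded_below ((A o\<^sub>L A) - ((norm A)\<^sup>2) *\<^sub>R id_blinfun)"
  then obtain c where c: "c > 0" "\<And>x. c * norm x \<le> norm (A (A x) - N\<^sup>2 *\<^sub>R x)"
    by (auto simp: bounded_below_def N_def blinfun.diff_left blinfun.scaleR_left)
  have key: "(c / N)\<^sup>2 * (norm x)\<^sup>2 + (norm (A x))\<^sup>2 \<le> N\<^sup>2 * (norm x)\<^sup>2" for x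
  proof -
    have "Re (cinner (A (A x)) x) = (norm (A x))\<^sup>2"
      by (simp add: selfadjointD[OF A, of "A x" x] Re_cinner_self)
    then have "(norm (A (A x) - N\<^sup>2 *\<^sub>R x))\<^sup>2
        = (norm (A (A x)))\<^sup>2 - 2 * N\<^sup>2 * (norm (A x))\<^sup>2 + N\<^sup>2 * N\<^sup>2 * (norm x)\<^sup>2"
      by (simp add: norm_diff_sq cinner_simps power_mult_distrib flip: power2_eq_square)
    also have "(norm (A (A x)))\<^sup>2 \<le> N\<^sup>2 * (norm (A x))\<^sup>2"
      using power_mono[OF norm_blinfun[of A "A x"], of 2] by (simp add: N_def power_mult_distrib)
    also have "c\<^sup>2 * (norm x)\<^sup>2 \<le> (norm (A (A x) - N\<^sup>2 *\<^sub>R x))\<^sup>2"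
      using power_mono[OF c(2)[of x], of 2] c(1) by (simp add: power_mult_distrib)
    ultimately have "c\<^sup>2 * (norm x)\<^sup>2 \<le> N\<^sup>2 * (N\<^sup>2 * (norm x)\<^sup>2 - (norm (A x))\<^sup>2)"
      by (simp add: algebra_simps)
    then show ?thesis
      using N by (simp add: power_divide field_simps)
  qed
  \<comment> \<open>By \<open>key\<close>, this k bounds A while k < N = norm A, a contradiction;
    \<open>max 0\<close> keeps the radicand nonnegative.\<close>
  define k where "k = sqrt (max 0 (N\<^sup>2 - (c / N)\<^sup>2))"
  have "norm (A x) \<le> k * norm x" for x
  proof (rule power2_le_imp_le)
    have "(norm (A x))\<^sup>2 \<le> (N\<^sup>2 - (c / N)\<^sup>2) * (norm x)\<^sup>2"
      using key[of x] by (simp add: algebra_simps)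
    also have "\<dots> \<le> (k * norm x)\<^sup>2"
      unfolding k_def power_mult_distrib by (intro mult_right_mono) auto
    finally show "(norm (A x))\<^sup>2 \<le> (k * norm x)\<^sup>2" .
  qed (simp add: k_def)
  then have "N \<le> k"
    unfolding N_def by (intro norm_blinfun_bound) (simp_all add: k_def)
  moreover have "k < sqrt (N\<^sup>2)"
    unfolding k_def using N c(1) by (intro real_sqrt_less_mono) (simp add: max_def)
  ultimately show False
    using N by simp
qed

text \<open>The second assumption says that the space is not zero. For N = norm A > 0, the operator
  A^2 - N^2 is not bounded below, so N or -N is in the spectrum.\<close>

lemma spectrum_nonempty:
  assumes A: "A \<in> selfadjoint_ops" and "\<not> bounded_below (0 :: 'a \<Rightarrow>\<^sub>L 'a)"
  obtains t where "complex_of_real t \<in> op_spectrum (A :: 'a :: complex_hilbert \<Rightarrow>\<^sub>L 'a)"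
proof (cases "norm A > 0")
  case True
  let ?q = "[: - complex_of_real ((norm A)\<^sup>2), 0, 1 :]"
  have "cpoly_op ?q A = (A o\<^sub>L A) - ((norm A)\<^sup>2) *\<^sub>R id_blinfun"
    by (rule blinfun_eqI)
      (simp add: blinfun.add_left blinfun.diff_left blinfun.scaleR_left scaleC_minus_left scaleC_of_real
        flip: of_real_power)
  then show ?thesis
    using cpoly_op_bounded_below[OF A, of ?q]
      selfadjoint_square_minus_norm_not_bounded_below[OF A True] that by auto
next
  case False
  then have "\<not> invertible_op (A - scalar_op (complex_of_real 0))"
    using assms(2) invertible_op_bounded_below by auto
  then show ?thesis
    using that[of 0] by (simp add: op_spectrum_iff)
qed

text \<open>If N = norm (p(A)) exceeded M, then p^2 - N^2 would have no zero on the spectrum and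
  p(A)^2 - N^2 would be bounded below. This is impossible for a self-adjoint operator of norm
  N.\<close>

lemma norm_op_poly_le:
  fixes A :: "'a :: complex_hilbert \<Rightarrow>\<^sub>L 'a"
  assumes A: "A \<in> selfadjoint_ops" and M: "0 \<le> M"
    and le: "\<And>t. complex_of_real t \<in> op_spectrum A \<Longrightarrow> \<bar>poly p t\<bar> \<le> M"
  shows "norm (op_poly p A) \<le> M"
proof (rule ccontr)
  define X where "X = op_poly p A"
  define N where "N = norm X"
  assume "\<not> norm (op_poly p A) \<le> M"
  then have N: "N > M"
    by (simp add: N_def X_def)
  have X: "X \<in> selfadjoint_ops"
    by (simp add: X_def selfadjoint_op_poly A)
  let ?q = "p * p - [:N\<^sup>2:]"
  have q: "poly ?q t \<noteq> 0" if "complex_of_real t \<in> op_spectrum A" for t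
  proof
    assume "poly ?q t = 0"
    then have "(poly p t)\<^sup>2 = N\<^sup>2"
      by (simp add: power2_eq_square)
    then have "\<bar>poly p t\<bar> = N"
      using N M by (auto simp: power2_eq_iff)
    then show False
      using le[OF that] N by simp
  qed
  \<comment> \<open>The space is nonzero, so the spectrum has a point; this shows that
    \<open>?q\<close> is not the zero polynomial.\<close>
  have "\<not> bounded_below (0 :: 'a \<Rightarrow>\<^sub>L 'a)"
  proof
    assume "bounded_below (0 :: 'a \<Rightarrow>\<^sub>L 'a)"
    then have "x = 0" for x :: 'a
      by (auto simp: bounded_below_def mult_le_0_iff)
    then have "X = 0"
      by (intro blinfun_eqI) simp
    then show False
      using N M by (simp add: N_def)
  qed
  then obtain t where "complex_of_real t \<in> op_spectrum A"
    using spectrum_nonempty[OF A] by blast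
  then have "?q \<noteq> 0"
    using q by force
  have "cpoly_op (map_poly complex_of_real ?q) A = (X o\<^sub>L X) - N\<^sup>2 *\<^sub>R id_blinfun"
  proof -
    have "map_poly complex_of_real ?q =
        map_poly complex_of_real p * map_poly complex_of_real p + [:complex_of_real (- N\<^sup>2):]"
      by (rule poly_eqI) (simp add: coeff_map_poly coeff_mult coeff_pCons split: nat.split)
    then show ?thesis
      by (simp add: cpoly_op_add cpoly_op_mult[OF selfadjoint_clinear[OF A]] X_def
          op_poly_eq_cpoly_op scalar_op_of_real del: of_real_minus of_real_power)
  qed
  moreover have "bounded_below (cpoly_op (map_poly complex_of_real ?q) A)"
    using q \<open>?q \<noteq> 0\<close> by (intro cpoly_op_bounded_below[OF A]) (simp_all only: poly_map_poly_of_real of_real_eq_0_iff map_poly_eq_0_iff of_real_0 simp_thms)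
  moreover have "norm X > 0"
    using N M unfolding N_def by linarith
  ultimately show False
    using selfadjoint_square_minus_norm_not_bounded_below[OF X] by (simp only: N_def)
qed

section \<open>Functional calculus\<close>

definition is_fun_calc ::
    "(real \<Rightarrow> real) \<Rightarrow> ('a :: complex_hilbert \<Rightarrow>\<^sub>L 'a) \<Rightarrow> ('a \<Rightarrow>\<^sub>L 'a) \<Rightarrow> bool" where
  "is_fun_calc f A F \<longleftrightarrow> (\<exists>p :: nat \<Rightarrow> real poly.
     uniform_limit {t. complex_of_real t \<in> op_spectrum A} (\<lambda>n. poly (p n)) f sequentially \<and>
     (\<lambda>n. op_poly (p n) A) \<longlonglongrightarrow> F)"

text \<open>Two approximating sequences differ on the spectrum by polynomials that are uniformly
  small, hence small in norm at A.\<close>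

lemma is_fun_calc_unique:
  assumes A: "A \<in> selfadjoint_ops" and "is_fun_calc f A F" "is_fun_calc f A G"
  shows "F = G"
proof -
  let ?S = "{t. complex_of_real t \<in> op_spectrum A}"
  obtain p where p: "uniform_limit ?S (\<lambda>n. poly (p n)) f sequentially" "(\<lambda>n. op_poly (p n) A) \<longlonglongrightarrow> F"
    using assms(2) by (auto simp: is_fun_calc_def)
  obtain q where q: "uniform_limit ?S (\<lambda>n. poly (q n)) f sequentially" "(\<lambda>n. op_poly (q n) A) \<longlonglongrightarrow> G"
    using assms(3) by (auto simp: is_fun_calc_def)
  have "uniform_limit ?S (\<lambda>n t. poly (p n) t - poly (q n) t) (\<lambda>t. f t - f t) sequentially"
    by (rule uniform_limit_minus[OF p(1) q(1)])
  then have ev: "\<forall>\<^sub>F n in sequentially. \<forall>t\<in>?S. \<bar>poly (p n - q n) t\<bar> < e" if "e > 0" for e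
    using that by (simp add: uniform_limit_iff dist_real_def)
  have small: "\<forall>\<^sub>F n in sequentially. norm (op_poly (p n) A - op_poly (q n) A) \<le> e" if "e > 0" for e
    using ev[OF that]
  proof eventually_elim
    case (elim n)
    then show ?case
      unfolding op_poly_diff[symmetric]
      using that by (intro norm_op_poly_le[OF A]) (auto intro: less_imp_le)
  qed
  have "(\<lambda>n. norm (op_poly (p n) A - op_poly (q n) A)) \<longlonglongrightarrow> norm (F - G)"
    by (intro tendsto_intros p q)
  then have "norm (F - G) \<le> e" if "e > 0" for e
    using small[OF that] by (intro tendsto_upperbound[where F = sequentially]) auto
  then have "norm (F - G) \<le> 0"
    by (rule field_le_epsilon[of _ 0, simplified])
  then show ?thesis
    by simp
qed

lemma op_fun_calc_eqI:
  assumes "A \<in> selfadjoint_ops" "is_fun_calc f A F"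
  shows "op_fun_calc f A = F"
  unfolding op_fun_calc_def is_fun_calc_def[symmetric]
  using assms is_fun_calc_unique by blast

lemma spectrum_le_norm:
  assumes "A \<in> selfadjoint_ops" "complex_of_real t \<in> op_spectrum A"
  shows "\<bar>t\<bar> \<le> norm A"
  using spectrum_approx_eigen[OF assms] approx_eigen_le_norm by metis

lemma Weierstrass_poly:
  fixes g :: "real \<Rightarrow> real"
  assumes "compact S" "continuous_on S g"
  obtains p :: "nat \<Rightarrow> real poly" where "uniform_limit S (\<lambda>n. poly (p n)) g sequentially"
proof -
  have "\<exists>p. \<forall>x\<in>S. \<bar>g x - poly p x\<bar> < inverse (real (Suc n))" for n
  proof -
    obtain h where h: "real_polynomial_function h" "\<And>x. x \<in> S \<Longrightarrow> \<bar>g x - h x\<bar> < inverse (real (Suc n))"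
      using Stone_Weierstrass_real_polynomial_function[OF assms, of "inverse (real (Suc n))"] by auto
    obtain a m where "h = (\<lambda>x. \<Sum>i\<le>m. a i * x ^ i)"
      using real_polynomial_function_imp_sum[OF h(1)] by auto
    then have "h x = poly (\<Sum>i\<le>m. monom (a i) i) x" for x
      by (simp add: poly_sum poly_monom)
    then show ?thesis
      using h(2) by (intro exI[of _ "\<Sum>i\<le>m. monom (a i) i"]) simp
  qed
  then obtain p where p: "\<And>n x. x \<in> S \<Longrightarrow> \<bar>g x - poly (p n) x\<bar> < inverse (real (Suc n))"
    by metis
  have "uniform_limit S (\<lambda>n. poly (p n)) g sequentially"
  proof (rule uniform_limitI)
    fix e :: real assume "e > 0"
    then have "\<forall>\<^sub>F n in sequentially. inverse (real (Suc n)) < e"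
      by (rule order_tendstoD(2)[OF LIMSEQ_inverse_real_of_nat])
    then show "\<forall>\<^sub>F n in sequentially. \<forall>x\<in>S. dist (poly (p n) x) (g x) < e"
      by eventually_elim (metis p less_trans dist_commute dist_real_def)
  qed
  then show ?thesis
    by (rule that)
qed

text \<open>The polynomials that approximate f on the spectrum are uniformly Cauchy there, hence
  Cauchy in operator norm at A. The continuous extension g permits approximation on an interval
  around the spectrum, so compactness of the spectrum itself is not at issue.\<close>

lemma is_fun_calc_op_fun_calc:
  assumes A: "A \<in> selfadjoint_ops" and g: "continuous_on UNIV g"
    and fg: "\<And>t. complex_of_real t \<in> op_spectrum A \<Longrightarrow> f t = g t"
  shows "is_fun_calc f A (op_fun_calc f A)"
proof -
  let ?S = "{t. complex_of_real t \<in> op_spectrum A}"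
  obtain p where p: "uniform_limit {- norm A..norm A} (\<lambda>n. poly (p n)) g sequentially"
    using Weierstrass_poly[OF compact_Icc continuous_on_subset[OF g subset_UNIV]] by metis
  have "?S \<subseteq> {- norm A..norm A}"
    using spectrum_le_norm[OF A] by (auto simp: abs_le_iff) (smt (verit))+
  then have pS: "uniform_limit ?S (\<lambda>n. poly (p n)) g sequentially"
    by (rule uniform_limit_on_subset[OF p])
  have "Cauchy (\<lambda>n. op_poly (p n) A)"
  proof (rule metric_CauchyI)
    fix e :: real assume e: "e > 0"
    have "uniformly_Cauchy_on ?S (\<lambda>n. poly (p n))"
      using pS by (intro uniformly_convergent_Cauchy) (auto simp: uniformly_convergent_on_def)
    then obtain M where M: "\<And>x m n. x \<in> ?S \<Longrightarrow> m \<ge> M \<Longrightarrow> n \<ge> M \<Longrightarrow> dist (poly (p m) x) (poly (p n) x) < e / 2"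
      using e unfolding uniformly_Cauchy_on_def by (metis half_gt_zero)
    have "norm (op_poly (p m - p n) A) \<le> e / 2" if "m \<ge> M" "n \<ge> M" for m n
      using M[OF _ that] e
      by (intro norm_op_poly_le[OF A]) (auto simp: dist_real_def intro!: less_imp_le)
    then show "\<exists>M. \<forall>m\<ge>M. \<forall>n\<ge>M. dist (op_poly (p m) A) (op_poly (p n) A) < e"
      using e by (intro exI[of _ M]) (force simp: dist_norm op_poly_diff)
  qed
  then obtain F where F: "(\<lambda>n. op_poly (p n) A) \<longlonglongrightarrow> F"
    using Cauchy_convergent convergent_def by blast
  have "uniform_limit ?S (\<lambda>n. poly (p n)) f sequentially"
    using pS fg by (simp add: uniform_limit_iff)
  with F have "is_fun_calc f A F"
    by (auto simp: is_fun_calc_def)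
  then show ?thesis
    using op_fun_calc_eqI[OF A] by metis
qed

lemma closed_selfadjoint_ops: "closed (selfadjoint_ops :: ('a :: complex_hilbert \<Rightarrow>\<^sub>L 'a) set)"
  unfolding closed_sequential_limits
proof safe
  fix X :: "nat \<Rightarrow> 'a \<Rightarrow>\<^sub>L 'a" and F
  assume X: "\<forall>n. X n \<in> selfadjoint_ops" and lim: "X \<longlonglongrightarrow> F"
  have ptw: "(\<lambda>n. X n x) \<longlonglongrightarrow> F x" for x
    by (intro tendsto_intros lim)
  have "cinner (F x) y = cinner x (F y)" for x y
  proof (rule LIMSEQ_unique)
    show "(\<lambda>n. cinner (X n x) y) \<longlonglongrightarrow> cinner (F x) y"
      by (intro bounded_bilinear.tendsto[OF bounded_bilinear_cinner] ptw tendsto_const)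
    show "(\<lambda>n. cinner (X n x) y) \<longlonglongrightarrow> cinner x (F y)"
      using X selfadjointD[of "X _" x y]
      by (auto intro!: bounded_bilinear.tendsto[OF bounded_bilinear_cinner] ptw tendsto_const)
  qed
  moreover have "F (c *\<^sub>C x) = c *\<^sub>C F x" for c x
  proof (rule LIMSEQ_unique[OF ptw])
    show "(\<lambda>n. X n (c *\<^sub>C x)) \<longlonglongrightarrow> c *\<^sub>C F x"
      using X bounded_linear.tendsto[OF bounded_linear_scaleC ptw]
      by (simp add: clinear_opD selfadjoint_clinear)
  qed
  ultimately show "F \<in> selfadjoint_ops"
    by (simp add: selfadjoint_ops_def clinear_op_def)
qed

lemma is_fun_calc_selfadjoint:
  assumes "A \<in> selfadjoint_ops" "is_fun_calc f A F"
  shows "F \<in> selfadjoint_ops"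
proof -
  obtain p where "(\<lambda>n. op_poly (p n) A) \<longlonglongrightarrow> F"
    using assms(2) by (auto simp: is_fun_calc_def)
  then show ?thesis
    by (rule closed_sequentially[OF closed_selfadjoint_ops selfadjoint_op_poly[OF assms(1)]])
qed

lemma approx_eigen_op_poly:
  assumes "approx_eigen A t x"
  shows "approx_eigen (op_poly p A) (poly p t) x"
proof -
  have "(\<lambda>n. op_poly p A (x n) - poly p t *\<^sub>R x n) \<longlonglongrightarrow> 0"
  proof (induction p)
    case (pCons a p)
    \<comment> \<open>The sum equals A p(A) x_n - t p(t) x_n; the constant coefficient a
      cancels.\<close>
    have "(\<lambda>n. A (op_poly p A (x n) - poly p t *\<^sub>R x n) + poly p t *\<^sub>R (A (x n) - t *\<^sub>R x n))
        \<longlonglongrightarrow> A 0 + poly p t *\<^sub>R 0"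
      using pCons.IH assms by (intro tendsto_intros) (simp_all add: approx_eigen_def)
    then show ?case
      by (simp add: blinfun.add_left blinfun.scaleR_left blinfun.diff_right blinfun.scaleR_right
          algebra_simps)
  qed simp
  then show ?thesis
    using assms by (simp add: approx_eigen_def)
qed

text \<open>A three-epsilon argument through p_n(A). Keeping the same sequence x permits the chain
  from A^2 to |A| to |A|^r.\<close>

lemma approx_eigen_fun_calc:
  assumes A: "A \<in> selfadjoint_ops" and F: "is_fun_calc f A F" and x: "approx_eigen A t x"
  shows "approx_eigen F (f t) x"
proof -
  obtain p where p: "uniform_limit {t. complex_of_real t \<in> op_spectrum A} (\<lambda>n. poly (p n)) f sequentially"
      "(\<lambda>n. op_poly (p n) A) \<longlonglongrightarrow> F"
    using F by (auto simp: is_fun_calc_def)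
  have pt: "(\<lambda>n. poly (p n) t) \<longlonglongrightarrow> f t"
    using p(1) approx_eigen_spectrum[OF x] by (auto intro: tendsto_uniform_limitI)
  have norm_x: "norm (x k) = 1" for k
    using x by (simp add: approx_eigen_def)
  have "(\<lambda>k. F (x k) - f t *\<^sub>R x k) \<longlonglongrightarrow> 0"
  proof (rule tendstoI)
    fix e :: real assume "e > 0"
    then have e: "e / 3 > 0"
      by simp
    have "\<forall>\<^sub>F n in sequentially. dist (op_poly (p n) A) F < e / 3 \<and> dist (poly (p n) t) (f t) < e / 3"
      using tendstoD[OF p(2) e] tendstoD[OF pt e] by (rule eventually_conj)
    then obtain n where n: "dist (op_poly (p n) A) F < e / 3" "dist (poly (p n) t) (f t) < e / 3"
      using eventually_happens'[OF sequentially_bot] by blast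
    have "\<forall>\<^sub>F k in sequentially. dist (op_poly (p n) A (x k) - poly (p n) t *\<^sub>R x k) 0 < e / 3"
      using approx_eigen_op_poly[OF x, of "p n"] e unfolding approx_eigen_def by (blast dest: tendstoD)
    then show "\<forall>\<^sub>F k in sequentially. dist (F (x k) - f t *\<^sub>R x k) 0 < e"
    proof eventually_elim
      case (elim k)
      have 1: "norm ((F - op_poly (p n) A) (x k)) < e / 3"
        using norm_blinfun[of "F - op_poly (p n) A" "x k"] n(1)
        by (simp add: norm_x dist_norm norm_minus_commute)
      have 2: "norm ((poly (p n) t - f t) *\<^sub>R x k) < e / 3"
        using n(2) by (simp add: norm_x dist_norm)
      have 3: "F (x k) - f t *\<^sub>R x k = (F - op_poly (p n) A) (x k)
          + (op_poly (p n) A (x k) - poly (p n) t *\<^sub>R x k) + (poly (p n) t - f t) *\<^sub>R x k"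
        by (simp add: blinfun.diff_left algebra_simps)
      show ?case
        using 1 2 elim norm_triangle_ineq[of "(F - op_poly (p n) A) (x k)"
            "op_poly (p n) A (x k) - poly (p n) t *\<^sub>R x k"]
          norm_triangle_ineq[of "(F - op_poly (p n) A) (x k)
            + (op_poly (p n) A (x k) - poly (p n) t *\<^sub>R x k)" "(poly (p n) t - f t) *\<^sub>R x k"]
        unfolding dist_norm diff_zero 3 by linarith
    qed
  qed
  then show ?thesis
    by (simp add: approx_eigen_def norm_x)
qed

text \<open>If \<open>-e \<le> p \<le> L\<close> on the spectrum, then \<open>\<parallel>p(A) - (L - e) / 2\<parallel> \<le> (L + e) / 2\<close>.\<close>

lemma op_poly_ge:
  assumes A: "A \<in> selfadjoint_ops" and e: "e \<ge> 0"
    and ge: "\<And>t. complex_of_real t \<in> op_spectrum A \<Longrightarrow> - e \<le> poly p t"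
  shows "- e * (norm x)\<^sup>2 \<le> Re (cinner (op_poly p A x) x)"
proof -
  define L where "L = norm (op_poly p A)"
  define Y where "Y = op_poly (p - [:(L - e) / 2:]) A"
  have Y: "Y x = op_poly p A x - ((L - e) / 2) *\<^sub>R x"
    by (simp add: Y_def op_poly_diff blinfun.diff_left blinfun.scaleR_left)
  have "norm Y \<le> (L + e) / 2"
    unfolding Y_def
  proof (rule norm_op_poly_le[OF A])
    show "0 \<le> (L + e) / 2"
      using e by (simp add: L_def)
    fix t assume t: "complex_of_real t \<in> op_spectrum A"
    obtain y where "approx_eigen A t y"
      by (rule spectrum_approx_eigen[OF A t])
    then have "\<bar>poly p t\<bar> \<le> L"
      unfolding L_def by (intro approx_eigen_le_norm approx_eigen_op_poly)
    then show "\<bar>poly (p - [:(L - e) / 2:]) t\<bar> \<le> (L + e) / 2"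
      using ge[OF t] by (simp add: abs_le_iff field_simps)
  qed
  then have "norm (Y x) * norm x \<le> (L + e) / 2 * norm x * norm x"
    by (intro mult_right_mono order_trans[OF norm_blinfun]) auto
  then have "- ((L + e) / 2 * (norm x)\<^sup>2) \<le> Re (cinner (Y x) x)"
    using cmod_cinner_le[of "Y x" x] abs_Re_le_cmod[of "cinner (Y x) x"]
    by (simp add: power2_eq_square mult.assoc abs_le_iff)
  then show ?thesis
    by (simp add: Y cinner_simps cinner_self field_simps)
qed

lemma is_fun_calc_nonneg:
  assumes A: "A \<in> selfadjoint_ops" and F: "is_fun_calc f A F"
    and nonneg: "\<And>t. complex_of_real t \<in> op_spectrum A \<Longrightarrow> 0 \<le> f t"
  shows "0 \<le> Re (cinner (F x) x)"
proof -
  obtain p where p: "uniform_limit {t. complex_of_real t \<in> op_spectrum A} (\<lambda>n. poly (p n)) f sequentially"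
      "(\<lambda>n. op_poly (p n) A) \<longlonglongrightarrow> F"
    using F by (auto simp: is_fun_calc_def)
  have lim: "(\<lambda>n. Re (cinner (op_poly (p n) A x) x)) \<longlonglongrightarrow> Re (cinner (F x) x)"
    by (intro tendsto_intros bounded_bilinear.tendsto[OF bounded_bilinear_cinner] p)
  have *: "- e * (norm x)\<^sup>2 \<le> Re (cinner (F x) x)" if "e > 0" for e
  proof (rule tendsto_lowerbound[OF lim])
    have "\<forall>\<^sub>F n in sequentially. \<forall>t\<in>{t. complex_of_real t \<in> op_spectrum A}. dist (poly (p n) t) (f t) < e"
      using p(1) that by (auto simp: uniform_limit_iff)
    then show "\<forall>\<^sub>F n in sequentially. - e * (norm x)\<^sup>2 \<le> Re (cinner (op_poly (p n) A x) x)"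
    proof eventually_elim
      case (elim n)
      have "- e \<le> poly (p n) t" if "complex_of_real t \<in> op_spectrum A" for t
        using elim nonneg[OF that] that by (force simp: dist_real_def)
      then show ?case
        using \<open>e > 0\<close> by (intro op_poly_ge[OF A]) auto
    qed
  qed simp
  show ?thesis
  proof (rule field_le_epsilon)
    fix e :: real assume e: "e > 0"
    \<comment> \<open>The summand 1 in the denominator covers x = 0.\<close>
    have "e / ((norm x)\<^sup>2 + 1) * (norm x)\<^sup>2 \<le> e"
      using e by (simp add: field_simps add_pos_nonneg add_nonneg_pos)
    then show "0 \<le> Re (cinner (F x) x) + e"
      using *[of "e / ((norm x)\<^sup>2 + 1)"] e by (simp add: add_nonneg_pos)
  qed
qed

section \<open>Absolute values and powers\<close>

lemma op_abs_eq:
  assumes "A \<in> selfadjoint_ops"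
  shows "op_abs A = op_fun_calc sqrt (A o\<^sub>L A)"
proof -
  have "op_adjoint A = A"
    by (rule op_adjoint_eqI) (rule selfadjointD[OF assms])
  then show ?thesis
    by (simp add: op_abs_def)
qed

text \<open>The norm bound with M = 0: a polynomial that vanishes on the spectrum, here X - 1,
  annihilates A. The next lemma uses X^2 - X.\<close>

lemma selfadjoint_spectrum_one:
  assumes A: "A \<in> selfadjoint_ops" and "\<And>t. complex_of_real t \<in> op_spectrum A \<Longrightarrow> t = 1"
  shows "A = id_blinfun"
proof -
  have "norm (op_poly [:- 1, 1:] A) \<le> 0"
    using assms(2) by (intro norm_op_poly_le[OF A]) auto
  moreover have "op_poly [:- 1, 1:] A = A - id_blinfun"
    by (rule blinfun_eqI) (simp add: blinfun.add_left blinfun.diff_left blinfun.minus_left)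
  ultimately show ?thesis
    by simp
qed

lemma selfadjoint_spectrum_zero_one:
  assumes A: "A \<in> selfadjoint_ops"
    and "\<And>t. complex_of_real t \<in> op_spectrum A \<Longrightarrow> t = 0 \<or> t = 1"
  shows "A o\<^sub>L A = A"
proof -
  have "norm (op_poly [:0, - 1, 1:] A) \<le> 0"
    using assms(2) by (intro norm_op_poly_le[OF A]) auto
  moreover have "op_poly [:0, - 1, 1:] A = (A o\<^sub>L A) - A"
    by (rule blinfun_eqI) (simp add: blinfun.add_left blinfun.diff_left blinfun.minus_left blinfun.diff_right blinfun.add_right blinfun.minus_right)
  ultimately show ?thesis
    by simp
qed

lemma selfadjoint_square: "A \<in> selfadjoint_ops \<Longrightarrow> A o\<^sub>L A \<in> selfadjoint_ops"
  by (rule selfadjoint_compose) auto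

lemma eq_id_of_spectrum_powr_abs:
  assumes A: "A \<in> selfadjoint_ops" and r: "r > 0"
    and spec: "op_spectrum (op_powr (op_abs A) r o\<^sub>L A) \<subseteq> {1}"
  shows "A = id_blinfun"
proof (rule selfadjoint_spectrum_one[OF A])
  fix t assume t: "complex_of_real t \<in> op_spectrum A"
  define K where "K = op_abs A"
  define C where "C = op_powr K r"
  have AA: "A o\<^sub>L A \<in> selfadjoint_ops"
    by (rule selfadjoint_square[OF A])
  have pos: "0 \<le> s" if s: "complex_of_real s \<in> op_spectrum (A o\<^sub>L A)" for s
  proof -
    obtain y where "approx_eigen (A o\<^sub>L A) s y"
      by (rule spectrum_approx_eigen[OF AA s])
    then show ?thesis
      by (rule approx_eigen_nonneg) (simp add: selfadjointD[OF A, of "A _"] Re_cinner_self)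
  qed
  have K: "is_fun_calc sqrt (A o\<^sub>L A) K"
    unfolding K_def op_abs_eq[OF A]
    by (rule is_fun_calc_op_fun_calc[OF AA, where g = sqrt]) (auto intro!: continuous_intros)
  have Ksa: "K \<in> selfadjoint_ops"
    by (rule is_fun_calc_selfadjoint[OF AA K])
  have Kpos: "0 \<le> s" if s: "complex_of_real s \<in> op_spectrum K" for s
  proof -
    obtain y where "approx_eigen K s y"
      by (rule spectrum_approx_eigen[OF Ksa s])
    then show ?thesis
      by (rule approx_eigen_nonneg) (use pos in \<open>auto intro: is_fun_calc_nonneg[OF AA K]\<close>)
  qed
  \<comment> \<open>A continuous function on the whole line that agrees with \<open>t powr r\<close>
    on the spectrum of K, which is nonnegative.\<close>
  have cont: "continuous_on UNIV (\<lambda>t :: real. \<bar>t\<bar> powr r)"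
    by (intro continuous_on_powr') (use r in \<open>auto intro!: continuous_intros\<close>)
  have C: "is_fun_calc (\<lambda>t. t powr r) K C"
    unfolding C_def op_powr_def
    by (rule is_fun_calc_op_fun_calc[OF Ksa, where g = "\<lambda>t. \<bar>t\<bar> powr r"])
      (use Kpos cont in auto)
  obtain x where x: "approx_eigen A t x"
    by (rule spectrum_approx_eigen[OF A t])
  have "op_poly [:0, 0, 1:] A = A o\<^sub>L A"
    by (rule blinfun_eqI) (simp add: blinfun.add_left)
  then have "approx_eigen (A o\<^sub>L A) (t\<^sup>2) x"
    using approx_eigen_op_poly[OF x, of "[:0, 0, 1:]"] by (simp add: power2_eq_square)
  from approx_eigen_fun_calc[OF AA K this] have "approx_eigen K \<bar>t\<bar> x"
    by simp
  from approx_eigen_fun_calc[OF Ksa C this] have Cx: "approx_eigen C (\<bar>t\<bar> powr r) x" .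
  \<comment> \<open>The sum is C A x_n - t |t|^r x_n, so x is approximate for the product C A as
    well.\<close>
  have "(\<lambda>n. C (A (x n) - t *\<^sub>R x n) + t *\<^sub>R (C (x n) - (\<bar>t\<bar> powr r) *\<^sub>R x n)) \<longlonglongrightarrow> C 0 + t *\<^sub>R 0"
    using x Cx by (intro tendsto_intros) (simp_all add: approx_eigen_def)
  then have "approx_eigen (C o\<^sub>L A) (t * \<bar>t\<bar> powr r) x"
    using x by (simp add: approx_eigen_def blinfun.diff_right blinfun.scaleR_right scaleR_diff_right)
  then have "complex_of_real (t * \<bar>t\<bar> powr r) \<in> op_spectrum (op_powr (op_abs A) r o\<^sub>L A)"
    unfolding C_def K_def by (rule approx_eigen_spectrum)
  then have eq: "t * \<bar>t\<bar> powr r = 1"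
    using spec by (metis of_real_eq_1_iff singletonD subsetD)
  then have "t * \<bar>t\<bar> powr r > 0"
    by simp
  \<comment> \<open>Since |t|^r >= 0, the sign is carried by t; this rules out t = -1.\<close>
  then have "t > 0"
    by (auto simp: zero_less_mult_iff)
  then have "t powr (1 + r) = 1"
    using eq by (simp add: powr_add)
  then have "(1 + r) * ln t = 0"
    using \<open>t > 0\<close> by (metis ln_one ln_powr)
  then show "t = 1"
    using r \<open>t > 0\<close> by simp
qed

text \<open>The spectrum of P lies in {0, 1}, whose points are fixed by the square root and by the
  power. The polynomial X therefore equals both functions there, and its constant sequence
  approximates them.\<close>

lemma op_powr_abs_projection:
  assumes P: "P \<in> selfadjoint_ops" and PP: "P o\<^sub>L P = P"
  shows "op_powr (op_abs P) r = P"
proof -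
  have "op_fun_calc f P = P" if f: "f 0 = 0" "f 1 = 1" for f
  proof (rule op_fun_calc_eqI[OF P])
    have *: "t = 0 \<or> t = 1" if t: "complex_of_real t \<in> op_spectrum P" for t
    proof -
      obtain x where "approx_eigen P t x"
        by (rule spectrum_approx_eigen[OF P t])
      then have "approx_eigen (op_poly [:0, - 1, 1:] P) (poly [:0, - 1, 1:] t) x"
        by (rule approx_eigen_op_poly)
      from approx_eigen_le_norm[OF this] have "\<bar>t * (t - 1)\<bar> \<le> norm (op_poly [:0, - 1, 1:] P)"
        by (simp add: algebra_simps)
      also have "op_poly [:0, - 1, 1:] P = (P o\<^sub>L P) - P"
        by (rule blinfun_eqI) (simp add: blinfun.add_left blinfun.diff_left blinfun.minus_left blinfun.diff_right blinfun.add_right blinfun.minus_right)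
      finally show ?thesis
        by (simp add: PP)
    qed
    have "uniform_limit {t. complex_of_real t \<in> op_spectrum P} (\<lambda>n. poly [:0, 1:]) f sequentially"
      by (rule uniform_limitI) (use * f in \<open>fastforce\<close>)
    moreover have "op_poly [:0, 1:] P = P"
      by (rule blinfun_eqI) (simp add: blinfun.add_left)
    ultimately show "is_fun_calc f P P"
      unfolding is_fun_calc_def by (intro exI[of _ "\<lambda>n. [:0, 1:]"]) simp
  qed
  then show ?thesis
    by (simp add: op_powr_def op_abs_eq[OF P] PP)
qed

section \<open>Rank-one operators and spectrum preservers\<close>

text \<open>The vector v is not normalized: the operator is then quadratic in v, and its
  parallelogram and mixed-term identities become available. Unit vectors give projections.\<close>

lift_definition rank_one :: "'a :: complex_hilbert \<Rightarrow> 'a \<Rightarrow>\<^sub>L 'a" is "\<lambda>v x. cinner x v *\<^sub>C v"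
proof (rule bounded_linear_intro)
  fix v x y :: 'a and r :: real
  show "cinner (x + y) v *\<^sub>C v = cinner x v *\<^sub>C v + cinner y v *\<^sub>C v"
    by (simp add: cinner_add_left scaleC_add_left)
  show "cinner (r *\<^sub>R x) v *\<^sub>C v = r *\<^sub>R cinner x v *\<^sub>C v"
    by (simp only: cinner_scaleR_left) (simp add: scaleR_scaleC scaleC_scaleC)
  show "norm (cinner x v *\<^sub>C v) \<le> norm x * (norm v * norm v)"
    using mult_right_mono[OF cmod_cinner_le[of x v], of "norm v"] by (simp add: norm_scaleC mult.assoc)
qed

declare rank_one.rep_eq [simp]

lemma selfadjoint_rank_one [simp]: "rank_one v \<in> selfadjoint_ops"
proof -
  have "cinner x v * cinner v y = cinner x v * cnj (cinner y v)" for x y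
    by (subst cinner_commute[of v y]) (rule refl)
  then show ?thesis
    by (simp add: selfadjoint_ops_def clinear_op_def cinner_simps scaleC_scaleC mult.commute)
qed

lemma rank_one_scaleC: "rank_one (c *\<^sub>C v) = (cmod c)\<^sup>2 *\<^sub>R rank_one v"
proof -
  have "complex_of_real ((cmod c)\<^sup>2) = cnj c * c"
    by (simp add: complex_norm_square mult.commute del: of_real_power)
  then show ?thesis
    by (intro blinfun_eqI)
      (simp add: blinfun.scaleR_left scaleR_scaleC cinner_simps scaleC_scaleC mult.commute mult.left_commute
        del: of_real_power)
qed

lemma rank_one_scaleR: "rank_one (s *\<^sub>R v) = s\<^sup>2 *\<^sub>R rank_one v"
  using rank_one_scaleC[of "complex_of_real s" v] by (simp add: scaleC_of_real)

lemma cinner_rank_one_apply: "cinner (rank_one v x) x = complex_of_real ((cmod (cinner x v))\<^sup>2)"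
  by (simp add: cinner_simps complex_norm_square cinner_commute[of v x] del: of_real_power)

lemma rank_one_apply_self: "rank_one v v = (norm v)\<^sup>2 *\<^sub>R v"
  by (simp add: cinner_self scaleR_scaleC)

lemma rank_one_eqD:
  assumes eq: "rank_one v = rank_one w"
  obtains c where "cmod c = 1" "w = c *\<^sub>C v"
proof (cases "v = 0 \<or> w = 0")
  case True
  have "rank_one v v = rank_one w v" "rank_one v w = rank_one w w"
    by (simp_all only: eq)
  with True have "v = 0" "w = 0"
    unfolding rank_one_apply_self by auto
  then show ?thesis
    using that[of 1] by simp
next
  case False
  have vw: "(norm v)\<^sup>2 *\<^sub>R v = cinner v w *\<^sub>C w"
    using rank_one_apply_self[of v] by (simp add: eq)
  then have "cinner v w \<noteq> 0"
    using False by auto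
  \<comment> \<open>Solves the relation \<open>vw\<close> for w.\<close>
  define c where "c = complex_of_real ((norm v)\<^sup>2) / cinner v w"
  have w: "w = c *\<^sub>C v"
  proof -
    have "c *\<^sub>C v = (1 / cinner v w) *\<^sub>C ((norm v)\<^sup>2 *\<^sub>R v)"
      by (simp add: c_def scaleR_scaleC scaleC_scaleC)
    then show ?thesis
      using \<open>cinner v w \<noteq> 0\<close> by (simp add: vw scaleC_scaleC)
  qed
  have "(norm v)\<^sup>2 *\<^sub>R v = (cmod c)\<^sup>2 *\<^sub>R (norm v)\<^sup>2 *\<^sub>R v"
    using eq rank_one_apply_self[of v] rank_one_scaleC[of c v] w by (metis blinfun.scaleR_left)
  then have "(cmod c)\<^sup>2 = 1"
    using False by simp
  then have "cmod c = 1"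
    using norm_ge_zero[of c] by (auto simp: power2_eq_1_iff)
  then show ?thesis
    using w that by blast
qed

lemma rank_one_projections_rank_one:
  assumes "norm e = 1"
  shows "rank_one e \<in> rank_one_projections"
proof -
  have ee: "cinner e e = 1"
    using assms by (simp add: cinner_self)
  have "range (blinfun_apply (rank_one e)) = range (\<lambda>c. c *\<^sub>C e)"
  proof (intro set_eqI iffI; elim rangeE)
    fix x c assume "x = c *\<^sub>C e"
    then have "x = rank_one e (c *\<^sub>C e)"
      by (simp add: cinner_simps ee)
    then show "x \<in> range (blinfun_apply (rank_one e))"
      by blast
  qed auto
  moreover have "e \<noteq> 0"
    using assms by auto
  moreover have "rank_one e o\<^sub>L rank_one e = rank_one e"
    by (rule blinfun_eqI) (simp add: cinner_simps ee)
  ultimately show ?thesis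
    by (auto simp: rank_one_projections_def)
qed

text \<open>If X^2 = bX, the Neumann series sums to an explicit resolvent, -(1/z)(1 + X/(z - b)).
  The cases in use are b = 0, b = 1 and, for \<open>rank_one e\<close> composed with B, b = <Be,
  e>.\<close>

lemma spectrum_quadratic:
  assumes X: "clinear_op X" and XX: "\<And>x. X (X x) = b *\<^sub>C X x" and z: "z \<in> op_spectrum X"
  shows "z = 0 \<or> z = b"
proof (rule ccontr)
  assume "\<not> ?thesis"
  then have nz: "z \<noteq> 0" "z - b \<noteq> 0"
    by auto
  define B where "B = scalar_op (- 1 / z) o\<^sub>L (id_blinfun + (scalar_op (1 / (z - b)) o\<^sub>L X))"
  have B: "B y = (- 1 / z) *\<^sub>C (y + (1 / (z - b)) *\<^sub>C X y)" for y
    by (simp add: B_def blinfun.add_left)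
  have eq: "X y - z *\<^sub>C y + (1 / (z - b)) *\<^sub>C (b *\<^sub>C X y - z *\<^sub>C X y) = - (z *\<^sub>C y)" for y
  proof -
    have "X y + (1 / (z - b)) *\<^sub>C (b *\<^sub>C X y - z *\<^sub>C X y) = (1 + (1 / (z - b)) * (b - z)) *\<^sub>C X y"
      by (simp add: scaleC_add_left scaleC_scaleC flip: scaleC_diff_left)
    also have "1 + (1 / (z - b)) * (b - z) = 0"
      using nz by (simp add: field_simps)
    finally show ?thesis
      by (simp add: algebra_simps)
  qed
  have "clinear_op B"
    by (simp add: B_def clinear_op_add clinear_op_compose X)
  moreover have "B o\<^sub>L (X - scalar_op z) = id_blinfun"
  proof (rule blinfun_eqI)
    fix y
    have "(B o\<^sub>L (X - scalar_op z)) y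
        = (- 1 / z) *\<^sub>C (X y - z *\<^sub>C y + (1 / (z - b)) *\<^sub>C (b *\<^sub>C X y - z *\<^sub>C X y))"
      by (simp only: B blinfun_apply_blinfun_compose blinfun.diff_left blinfun.diff_right
          apply_scalar_op XX clinear_opD[OF X] scaleC_diff_right scaleC_add_right)
        (simp add: algebra_simps)
    then show "(B o\<^sub>L (X - scalar_op z)) y = id_blinfun y"
      using nz by (simp only: eq) (simp add: scaleC_minus_left scaleC_minus_right scaleC_scaleC)
  qed
  moreover have "(X - scalar_op z) o\<^sub>L B = id_blinfun"
  proof (rule blinfun_eqI)
    fix y
    have "((X - scalar_op z) o\<^sub>L B) y
        = (- 1 / z) *\<^sub>C (X y - z *\<^sub>C y + (1 / (z - b)) *\<^sub>C (b *\<^sub>C X y - z *\<^sub>C X y))"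
    proof -
      have "X (B y) = (- 1 / z) *\<^sub>C (X y + (1 / (z - b)) *\<^sub>C b *\<^sub>C X y)"
        by (simp only: B clinear_opD[OF X] blinfun.add_right XX)
      moreover have "z *\<^sub>C B y = (- 1 / z) *\<^sub>C (z *\<^sub>C y + (1 / (z - b)) *\<^sub>C z *\<^sub>C X y)"
        by (simp only: B scaleC_add_right scaleC_scaleC mult.commute mult.left_commute)
      ultimately show ?thesis
        by (simp only: blinfun_apply_blinfun_compose blinfun.diff_left apply_scalar_op
            scaleC_diff_right scaleC_add_right) (simp add: algebra_simps)
    qed
    then show "((X - scalar_op z) o\<^sub>L B) y = id_blinfun y"
      using nz by (simp only: eq) (simp add: scaleC_minus_left scaleC_minus_right scaleC_scaleC)
  qed
  ultimately have "invertible_op (X - scalar_op z)"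
    by (auto simp: invertible_op_def)
  then show False
    using z by (simp add: op_spectrum_iff)
qed

lemma spectrum_projection:
  assumes "P \<in> selfadjoint_ops" "P o\<^sub>L P = P" "z \<in> op_spectrum P"
  shows "z = 0 \<or> z = 1"
proof (rule spectrum_quadratic[OF selfadjoint_clinear[OF assms(1)] _ assms(3)])
  show "P (P x) = 1 *\<^sub>C P x" for x
    using assms(2) by (metis blinfun_apply_blinfun_compose scaleC_one)
qed

lemma eigenvalue_spectrum:
  fixes X :: "'a :: complex_hilbert \<Rightarrow>\<^sub>L 'a"
  assumes "X x = z *\<^sub>C x" "x \<noteq> 0"
  shows "z \<in> op_spectrum X"
proof (rule ccontr)
  assume "z \<notin> op_spectrum X"
  then obtain c where c: "c > 0" "\<And>x. c * norm x \<le> norm ((X - scalar_op z) x)"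
    using invertible_op_bounded_below by (auto simp: op_spectrum_iff bounded_below_def)
  then show False
    using c(2)[of x] assms by (simp add: blinfun.diff_left mult_le_0_iff)
qed

lemma spectrum_zero: "op_spectrum 0 \<subseteq> {0}"
  using spectrum_quadratic[of 0 0] by auto

lemma id_blinfun_compose [simp]: "id_blinfun o\<^sub>L A = A" "A o\<^sub>L id_blinfun = A"
  by (rule blinfun_eqI, simp)+

lemma spectrum_id: "op_spectrum id_blinfun \<subseteq> {1}"
proof safe
  fix z :: complex assume z: "z \<in> op_spectrum (id_blinfun :: 'a \<Rightarrow>\<^sub>L 'a)"
  have "invertible_op (id_blinfun :: 'a \<Rightarrow>\<^sub>L 'a)"
    by (auto simp: invertible_op_def intro!: exI[of _ id_blinfun])
  then have "z \<noteq> 0"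
    using z by (auto simp: op_spectrum_iff)
  then show "z = 1"
    using spectrum_projection[OF selfadjoint_id _ z] by simp
qed

text \<open>With P = \<open>rank_one e\<close>, one has PBPB = <Be, e> PB and PBe = <Be, e> e. The
  value 0 is excluded because its membership also depends on the dimension.\<close>

lemma spectrum_rank_one_compose:
  assumes e: "norm e = 1" and B: "B \<in> selfadjoint_ops" and "z \<noteq> 0"
  shows "z \<in> op_spectrum (rank_one e o\<^sub>L B) \<longleftrightarrow> z = cinner (B e) e"
proof
  assume z: "z \<in> op_spectrum (rank_one e o\<^sub>L B)"
  have "z = 0 \<or> z = cinner (B e) e"
  proof (rule spectrum_quadratic[OF _ _ z])
    show "clinear_op (rank_one e o\<^sub>L B)"
      by (intro clinear_op_compose selfadjoint_clinear B selfadjoint_rank_one)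
    show "(rank_one e o\<^sub>L B) ((rank_one e o\<^sub>L B) x) = cinner (B e) e *\<^sub>C (rank_one e o\<^sub>L B) x" for x
      by (simp add: clinear_opD[OF selfadjoint_clinear[OF B]] cinner_simps scaleC_scaleC mult.commute)
  qed
  then show "z = cinner (B e) e"
    using \<open>z \<noteq> 0\<close> by simp
next
  assume "z = cinner (B e) e"
  then show "z \<in> op_spectrum (rank_one e o\<^sub>L B)"
    using e by (intro eigenvalue_spectrum[of _ e]) auto
qed

lemma nonzero_projection_unit_vector:
  fixes P :: "'a :: complex_hilbert \<Rightarrow>\<^sub>L 'a"
  assumes "P o\<^sub>L P = P" "P \<noteq> 0"
  obtains e where "norm e = 1" "P e = e"
proof -
  obtain x where x: "P x \<noteq> 0"
    using assms(2) by (metis blinfun_eqI zero_blinfun.rep_eq)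
  have "P (P x) = P x"
    using assms(1) by (metis blinfun_apply_blinfun_compose)
  then show ?thesis
    using x by (intro that[of "(1 / norm (P x)) *\<^sub>R P x"]) (simp_all add: blinfun.scaleR_right)
qed

section \<open>Consequences of the spectral identity\<close>

locale spectrum_preserver =
  fixes \<phi> :: "('a :: complex_hilbert \<Rightarrow>\<^sub>L 'a) \<Rightarrow> ('a \<Rightarrow>\<^sub>L 'a)" and r :: real
  assumes r: "r > 0"
    and image: "\<phi> ` selfadjoint_ops = selfadjoint_ops"
    and spectrum_eq: "\<And>A B. A \<in> rank_one_projections \<union> {id_blinfun} \<Longrightarrow> B \<in> selfadjoint_ops \<Longrightarrow>
      op_spectrum (op_powr (op_abs A) r o\<^sub>L B) = op_spectrum (op_powr (op_abs (\<phi> A)) r o\<^sub>L \<phi> B)"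
begin

lemma selfadjoint_map: "A \<in> selfadjoint_ops \<Longrightarrow> \<phi> A \<in> selfadjoint_ops"
  using image by blast

lemma map_id: "\<phi> id_blinfun = id_blinfun"
proof (rule eq_id_of_spectrum_powr_abs[OF _ r])
  show "op_spectrum (op_powr (op_abs (\<phi> id_blinfun)) r o\<^sub>L \<phi> id_blinfun) \<subseteq> {1}"
    using spectrum_eq[of id_blinfun id_blinfun] spectrum_id[where ?'a = 'a] by (simp add: op_powr_abs_projection)
qed (simp add: selfadjoint_map)

lemma spectrum_map: "B \<in> selfadjoint_ops \<Longrightarrow> op_spectrum (\<phi> B) = op_spectrum B"
  using spectrum_eq[of id_blinfun B] by (simp add: op_powr_abs_projection map_id)

lemma rank_one_projection_compose: "norm e = 1 \<Longrightarrow> rank_one e o\<^sub>L rank_one e = rank_one e"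
  using rank_one_projections_rank_one[of e] by (simp add: rank_one_projections_def)

lemma one_in_spectrum_rank_one:
  assumes "norm e = 1"
  shows "1 \<in> op_spectrum (rank_one e)"
  using assms by (intro eigenvalue_spectrum[of _ e]) (auto simp: cinner_self)

text \<open>Serves both directions: for the image of a rank-one projection and for a preimage of
  one.\<close>

lemma projection_of_spectrum_rank_one:
  assumes B: "B \<in> selfadjoint_ops" and e: "norm e = 1" and spec: "op_spectrum B = op_spectrum (rank_one e)"
  shows "B o\<^sub>L B = B" "B \<noteq> 0"
proof -
  show "B o\<^sub>L B = B"
  proof (rule selfadjoint_spectrum_zero_one[OF B])
    fix t assume "complex_of_real t \<in> op_spectrum B"
    then show "t = 0 \<or> t = 1"
      using spectrum_projection[OF selfadjoint_rank_one rank_one_projection_compose[OF e]] spec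
      by (metis of_real_eq_0_iff of_real_eq_1_iff)
  qed
  show "B \<noteq> 0"
    using one_in_spectrum_rank_one[OF e] spectrum_zero spec by auto
qed

lemma map_rank_one_projection:
  assumes "norm e = 1"
  shows "\<phi> (rank_one e) o\<^sub>L \<phi> (rank_one e) = \<phi> (rank_one e)" "\<phi> (rank_one e) \<noteq> 0"
  using projection_of_spectrum_rank_one[OF _ assms spectrum_map] by (simp_all add: selfadjoint_map)

lemma spectrum_rank_one_map:
  assumes e: "norm e = 1" and B: "B \<in> selfadjoint_ops"
  shows "op_spectrum (\<phi> (rank_one e) o\<^sub>L \<phi> B) = op_spectrum (rank_one e o\<^sub>L B)"
  using spectrum_eq[of "rank_one e" B] e B
  by (simp add: op_powr_abs_projection selfadjoint_map map_rank_one_projection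
      rank_one_projections_rank_one rank_one_projection_compose)

text \<open>If the range of \<open>\<phi> (rank_one e)\<close> contained two orthogonal unit vectors \<open>f\<close> and \<open>g\<close>, testing
  against the projection on \<open>f\<close> plus twice that on \<open>g\<close> would give two nonzero spectral values.\<close>

lemma map_rank_one_unit:
  assumes e: "norm e = 1"
  obtains f where "norm f = 1" "\<phi> (rank_one e) = rank_one f"
proof -
  define Q where "Q = \<phi> (rank_one e)"
  have Q: "Q \<in> selfadjoint_ops" and QQ: "Q o\<^sub>L Q = Q" and "Q \<noteq> 0"
    by (simp_all add: Q_def selfadjoint_map map_rank_one_projection[OF e])
  obtain f where f: "norm f = 1" "Q f = f"
    using nonzero_projection_unit_vector[OF QQ \<open>Q \<noteq> 0\<close>] .
  have Q2: "Q (Q y) = Q y" for y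
    using QQ by (metis blinfun_apply_blinfun_compose)
  have ff: "cinner f f = 1"
    using f(1) by (simp add: cinner_self)
  have "Q y = rank_one f y" for y
  proof (rule ccontr)
    assume neq: "Q y \<noteq> rank_one f y"
    define h where "h = Q y - rank_one f y"
    define g where "g = (1 / norm h) *\<^sub>R h"
    have "Q h = h"
      by (simp add: h_def blinfun.diff_right Q2 clinear_opD[OF selfadjoint_clinear[OF Q]] f)
    moreover have "cinner h f = 0"
      using selfadjointD[OF Q, of y f] by (simp add: h_def cinner_simps f ff)
    ultimately have g: "norm g = 1" "Q g = g" "cinner g f = 0"
      using neq by (simp_all add: g_def h_def blinfun.scaleR_right cinner_simps)
    then have gg: "cinner g g = 1" and fg: "cinner f g = 0"
      by (simp_all add: cinner_self cinner_commute[of f g])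
    define X where "X = rank_one f + 2 *\<^sub>R rank_one g"
    have "X \<in> selfadjoint_ops"
      by (simp add: X_def selfadjoint_add selfadjoint_scaleR)
    then have "X \<in> \<phi> ` selfadjoint_ops"
      by (simp only: image)
    then obtain B where B: "B \<in> selfadjoint_ops" "\<phi> B = X"
      by blast
    have "1 \<in> op_spectrum (Q o\<^sub>L X)"
      using f by (intro eigenvalue_spectrum[of _ f])
        (auto simp: X_def blinfun.add_left blinfun.scaleR_left ff fg)
    moreover have "2 \<in> op_spectrum (Q o\<^sub>L X)"
      using g scaleC_of_real[of 2 g] by (intro eigenvalue_spectrum[of _ g])
        (auto simp: X_def blinfun.add_left blinfun.scaleR_left gg blinfun.scaleR_right)
    ultimately have "1 = cinner (B e) e" "2 = cinner (B e) e"
      using spectrum_rank_one_map[OF e B(1)] spectrum_rank_one_compose[OF e B(1)]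
      by (simp_all add: B Q_def)
    then show False
      by simp
  qed
  then show ?thesis
    using that[OF f(1)] by (simp add: Q_def blinfun_eqI)
qed

text \<open>Each number, if nonzero, is the only nonzero point of the common spectrum; so if one
  vanishes, the other does too.\<close>

lemma cinner_map_unit:
  assumes "norm e = 1" "norm f = 1" "\<phi> (rank_one e) = rank_one f" and B: "B \<in> selfadjoint_ops"
  shows "cinner (\<phi> B f) f = cinner (B e) e"
  using spectrum_rank_one_map[OF assms(1) B] spectrum_rank_one_compose[OF assms(1) B]
    spectrum_rank_one_compose[OF assms(2) selfadjoint_map[OF B]]
  unfolding assms(3) by (metis (no_types))

text \<open>A preimage B of \<open>rank_one h\<close> is a nonzero projection. For a unit vector e
  fixed by B, \<phi> sends \<open>rank_one e\<close> to \<open>rank_one f\<close> with |<f, h>|^2 =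
  <Be, e> = 1, and equality in Cauchy-Schwarz makes f a multiple of h.\<close>

lemma surj_rank_one_unit:
  assumes h: "norm h = 1"
  obtains e where "norm e = 1" "\<phi> (rank_one e) = rank_one h"
proof -
  obtain B where B: "B \<in> selfadjoint_ops" "\<phi> B = rank_one h"
    using image selfadjoint_rank_one[of h] by (metis imageE)
  obtain e where e: "norm e = 1" "B e = e"
    using nonzero_projection_unit_vector projection_of_spectrum_rank_one[OF B(1) h] spectrum_map[OF B(1)] B(2)
    by metis
  obtain f where f: "norm f = 1" "\<phi> (rank_one e) = rank_one f"
    using map_rank_one_unit[OF e(1)] .
  have "cinner (rank_one h f) f = 1"
    using cinner_map_unit[OF e(1) f B(1)] e by (simp add: B cinner_self)
  then have *: "(cmod (cinner f h))\<^sup>2 = 1"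
    unfolding cinner_rank_one_apply by (simp only: of_real_eq_1_iff)
  then have "f = cinner f h *\<^sub>C h"
    using norm_diff_proj_sq[OF h, of f] f(1) by simp
  then have "rank_one f = rank_one h"
    using rank_one_scaleC[of "cinner f h" h] * by simp
  then show ?thesis
    using that e f by simp
qed

lemma selfadjoint_eqI_map:
  assumes "C \<in> selfadjoint_ops" "D \<in> selfadjoint_ops"
    and "\<And>e f. norm e = 1 \<Longrightarrow> norm f = 1 \<Longrightarrow> \<phi> (rank_one e) = rank_one f \<Longrightarrow> cinner (C f) f = cinner (D f) f"
  shows "C = D"
proof (rule selfadjoint_eqI[OF assms(1,2)])
  fix f :: 'a assume f: "norm f = 1"
  obtain e where "norm e = 1" "\<phi> (rank_one e) = rank_one f"
    by (rule surj_rank_one_unit[OF f])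
  then show "Re (cinner (C f) f) = Re (cinner (D f) f)"
    using assms(3) f by simp
qed

lemma map_add:
  assumes "A \<in> selfadjoint_ops" "B \<in> selfadjoint_ops"
  shows "\<phi> (A + B) = \<phi> A + \<phi> B"
  by (rule selfadjoint_eqI_map)
    (simp_all add: assms selfadjoint_map selfadjoint_add cinner_map_unit blinfun.add_left cinner_simps)

lemma map_scaleR:
  assumes "A \<in> selfadjoint_ops"
  shows "\<phi> (s *\<^sub>R A) = s *\<^sub>R \<phi> A"
  by (rule selfadjoint_eqI_map)
    (simp_all add: assms selfadjoint_map selfadjoint_scaleR cinner_map_unit blinfun.scaleR_left cinner_simps)

lemma map_diff:
  assumes "A \<in> selfadjoint_ops" "B \<in> selfadjoint_ops"
  shows "\<phi> (A - B) = \<phi> A - \<phi> B"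
  using map_add[OF assms(1) selfadjoint_scaleR[OF assms(2), of "-1"]] map_scaleR[OF assms(2), of "-1"]
  by simp

lemma map_rank_one:
  obtains w where "norm w = norm v" "\<phi> (rank_one v) = rank_one w"
    "\<And>B. B \<in> selfadjoint_ops \<Longrightarrow> cinner (\<phi> B w) w = cinner (B v) v"
proof (cases "v = 0")
  case True
  then have "rank_one v = 0 *\<^sub>R id_blinfun"
    by (intro blinfun_eqI) simp
  then have "\<phi> (rank_one v) = rank_one v"
    using map_scaleR[OF selfadjoint_id, of 0] by simp
  then show ?thesis
    using that[of v] True by simp
next
  case False
  define e where "e = (1 / norm v) *\<^sub>R v"
  have e: "norm e = 1" and v: "v = norm v *\<^sub>R e"
    using False by (simp_all add: e_def)
  obtain f where f: "norm f = 1" "\<phi> (rank_one e) = rank_one f"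
    by (rule map_rank_one_unit[OF e])
  show ?thesis
  proof (rule that[of "norm v *\<^sub>R f"])
    have "\<phi> (rank_one (norm v *\<^sub>R e)) = rank_one (norm v *\<^sub>R f)"
      unfolding rank_one_scaleR by (simp add: map_scaleR f)
    then show "\<phi> (rank_one v) = rank_one (norm v *\<^sub>R f)"
      by (simp only: v[symmetric])
    fix B :: "'a \<Rightarrow>\<^sub>L 'a" assume "B \<in> selfadjoint_ops"
    then have "cinner (\<phi> B (norm v *\<^sub>R f)) (norm v *\<^sub>R f) = cinner (B (norm v *\<^sub>R e)) (norm v *\<^sub>R e)"
      using cinner_map_unit[OF e f] by (simp add: blinfun.scaleR_right cinner_simps)
    then show "cinner (\<phi> B (norm v *\<^sub>R f)) (norm v *\<^sub>R f) = cinner (B v) v"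
      by (simp only: v[symmetric])
  qed (simp add: f)
qed

text \<open>Any w may be used, since it differs from the vector supplied by
  \<open>map_rank_one\<close> only by a phase, which cancels in the form.\<close>

lemma cinner_map:
  assumes "\<phi> (rank_one v) = rank_one w" and B: "B \<in> selfadjoint_ops"
  shows "cinner (\<phi> B w) w = cinner (B v) v"
proof -
  obtain u where u: "\<phi> (rank_one v) = rank_one u" "cinner (\<phi> B u) u = cinner (B v) v"
    using map_rank_one[of v] B by metis
  obtain c where c: "cmod c = 1" "w = c *\<^sub>C u"
    using rank_one_eqD assms(1) u(1) by metis
  have "cnj c * c = 1"
    using c(1) by (simp add: mult.commute[of "cnj c"] complex_norm_square[symmetric])
  then show ?thesis
    using u(2) by (simp add: c(2) clinear_opD[OF selfadjoint_clinear[OF selfadjoint_map[OF B]]]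
        cinner_simps flip: mult.assoc)
qed

end

section \<open>The implementing isometry\<close>

locale spectrum_preserver_pair = spectrum_preserver \<phi> r
  for \<phi> :: "('a :: complex_hilbert \<Rightarrow>\<^sub>L 'a) \<Rightarrow> ('a \<Rightarrow>\<^sub>L 'a)" and r :: real +
  fixes e f :: 'a
  assumes e: "norm e = 1" and f: "norm f = 1" and ef: "\<phi> (rank_one e) = rank_one f"
begin

text \<open>\<open>U\<close> is the restriction to the orthogonal complement of \<open>e\<close> of the isometry that
  implements \<open>\<phi>\<close>, normalized by \<open>e \<mapsto> f\<close>.\<close>

definition U :: "'a \<Rightarrow> 'a" where
  "U x = \<phi> (rank_one (e + x)) f - f"

lemma cinner_ee [simp]: "cinner e e = 1"
  using e by (simp add: cinner_self)

lemma cinner_ff [simp]: "cinner f f = 1"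
  using f by (simp add: cinner_self)

lemma orth_commute: "cinner x e = 0 \<Longrightarrow> cinner e x = 0"
  by (simp add: cinner_commute[of e x])

text \<open>If the image is \<open>rank_one w\<close>, then |<f, w>|^2 = |<e, x>|^2 = 0. This
  removes the part quadratic in x from \<open>U\<close>.\<close>

lemma map_rank_one_orth:
  assumes "cinner x e = 0"
  shows "\<phi> (rank_one x) f = 0"
proof -
  obtain w where w: "\<phi> (rank_one x) = rank_one w"
    using map_rank_one[of x] by metis
  have "cinner (rank_one w f) f = cinner (rank_one x e) e"
    using cinner_map[OF ef, of "rank_one x"] by (simp add: w)
  then have "cinner f w = 0"
    using assms unfolding cinner_rank_one_apply by (simp add: orth_commute)
  then show ?thesis
    by (simp add: w)
qed

text \<open>The mixed part of \<open>rank_one (e + x)\<close>. One of its two summands is linear in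
  x and the other conjugate linear, so it is real linear; being self-adjoint, it is also within
  reach of the linearity of \<phi>.\<close>

definition cross :: "'a \<Rightarrow> 'a \<Rightarrow>\<^sub>L 'a" where
  "cross x = rank_one (e + x) - rank_one e - rank_one x"

lemma selfadjoint_cross: "cross x \<in> selfadjoint_ops"
  by (simp add: cross_def selfadjoint_diff)

lemma cross_apply: "cross x v = cinner v e *\<^sub>C x + cinner v x *\<^sub>C e"
  by (simp add: cross_def blinfun.diff_left cinner_simps scaleC_add_left scaleC_add_right)

lemma cross_add: "cross (x + y) = cross x + cross y"
  by (rule blinfun_eqI)
    (simp add: cross_apply blinfun.add_left cinner_simps scaleC_add_left scaleC_add_right)

lemma cross_scaleR: "cross (s *\<^sub>R x) = s *\<^sub>R cross x"
  by (rule blinfun_eqI)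
    (simp add: cross_apply blinfun.scaleR_left cinner_scaleR_right scaleR_add_right,
     simp add: scaleR_scaleC scaleC_scaleC mult.commute)

lemma U_cross:
  assumes "cinner x e = 0"
  shows "U x = \<phi> (cross x) f"
  by (simp add: U_def cross_def map_diff selfadjoint_diff blinfun.diff_left ef map_rank_one_orth[OF assms])

lemma U_add: "cinner x e = 0 \<Longrightarrow> cinner y e = 0 \<Longrightarrow> U (x + y) = U x + U y"
  by (simp add: U_cross cinner_add_left cross_add map_add selfadjoint_cross blinfun.add_left)

lemma U_scaleR: "cinner x e = 0 \<Longrightarrow> U (s *\<^sub>R x) = s *\<^sub>R U x"
  by (simp add: U_cross cinner_scaleR_left cross_scaleR map_scaleR selfadjoint_cross blinfun.scaleR_left)

text \<open>Write the image as \<open>rank_one w\<close>. Then |<f, w>|^2 = |<e, e + x>|^2 = 1, so f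
  + U x = <f, w> w is w with its phase fixed by <f + U x, f> = 1. The norm of U x follows by
  Pythagoras from norm w = norm (e + x).\<close>

lemma U_plus:
  assumes x: "cinner x e = 0"
  shows "\<phi> (rank_one (e + x)) = rank_one (f + U x)"
    and "cinner (U x) f = 0"
    and "norm (U x) = norm x"
proof -
  obtain w where w: "norm w = norm (e + x)" "\<phi> (rank_one (e + x)) = rank_one w"
    using map_rank_one[of "e + x"] by metis
  have "cinner (rank_one w f) f = cinner (rank_one (e + x) e) e"
    using cinner_map[OF ef, of "rank_one (e + x)"] by (simp add: w)
  also have "\<dots> = 1"
    by (simp add: cinner_simps x orth_commute)
  finally have sq: "complex_of_real ((cmod (cinner f w))\<^sup>2) = 1"
    unfolding cinner_rank_one_apply .
  then have "(cmod (cinner f w))\<^sup>2 = 1"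
    by (simp only: of_real_eq_1_iff)
  then have c: "cmod (cinner f w) = 1"
    using norm_ge_zero[of "cinner f w"] by (auto simp: power2_eq_1_iff)
  have c': "cinner f w * cinner w f = 1"
    using sq unfolding complex_norm_square cinner_commute[of w f] .
  have U: "f + U x = cinner f w *\<^sub>C w"
    by (simp add: U_def w)
  then show "\<phi> (rank_one (e + x)) = rank_one (f + U x)"
    by (simp add: w rank_one_scaleC c)
  have "cinner (f + U x) f = 1"
    by (simp add: U cinner_scaleC_left c')
  then show orth: "cinner (U x) f = 0"
    by (simp add: cinner_add_left)
  have "norm (f + U x) = norm (e + x)"
    by (simp add: U norm_scaleC c w)
  then have "(norm (f + U x))\<^sup>2 = (norm (e + x))\<^sup>2"
    by simp
  moreover have "Re (cinner f (U x)) = 0" "Re (cinner e x) = 0"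
    using orth x by (simp_all add: Re_cinner_commute[of f] Re_cinner_commute[of e])
  ultimately show "norm (U x) = norm x"
    by (simp add: norm_add_sq e f)
qed

text \<open>\<phi> is applied to the parallelogram identity for e + x and e - x, whose images are
  known.\<close>

lemma map_rank_one_U:
  assumes x: "cinner x e = 0"
  shows "\<phi> (rank_one x) = rank_one (U x)"
proof -
  have parallelogram: "rank_one (a + y) + rank_one (a - y) = 2 *\<^sub>R (rank_one a + rank_one y)" for a y :: 'a
    by (rule blinfun_eqI)
      (simp add: blinfun.add_left blinfun.scaleR_left cinner_simps scaleC_add_left scaleC_add_right
        scaleC_diff_left scaleC_diff_right scaleR_2 algebra_simps)
  have mx: "cinner (- x) e = 0"
    using x by (simp add: cinner_minus_left)
  have "U (- x) = - U x"
    using U_scaleR[OF x, of "-1"] by simp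
  then have "\<phi> (rank_one (e - x)) = rank_one (f - U x)"
    using U_plus(1)[OF mx] by simp
  then have "rank_one (f + U x) + rank_one (f - U x) = \<phi> (rank_one (e + x) + rank_one (e - x))"
    by (simp add: map_add U_plus(1)[OF x])
  then have "2 *\<^sub>R (rank_one f + rank_one (U x)) = 2 *\<^sub>R (rank_one f + \<phi> (rank_one x))"
    unfolding parallelogram by (simp add: map_scaleR map_add selfadjoint_add ef)
  then show ?thesis
    by simp
qed

text \<open>The operator is a quadratic polynomial in s, and \<phi> is known on each
  coefficient.\<close>

lemma map_rank_one_real:
  assumes x: "cinner x e = 0"
  shows "\<phi> (rank_one (s *\<^sub>R e + x)) = rank_one (s *\<^sub>R f + U x)"
proof -
  have expand: "rank_one (s *\<^sub>R a + y) =
      s\<^sup>2 *\<^sub>R rank_one a + s *\<^sub>R (rank_one (a + y) - rank_one a - rank_one y) + rank_one y" for a y :: 'a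
    by (rule blinfun_eqI)
      (simp add: blinfun.add_left blinfun.diff_left blinfun.scaleR_left cinner_simps
        scaleC_add_left scaleC_add_right scaleR_add_right distrib_left scaleR_scaleC scaleC_scaleC power2_eq_square
        mult.commute mult.left_commute)
  show ?thesis
    unfolding expand
    by (simp add: map_add map_diff map_scaleR selfadjoint_add selfadjoint_diff selfadjoint_scaleR
        ef U_plus(1)[OF x] map_rank_one_U[OF x])
qed

text \<open>x and ix have the same rank-one operator, so U(ix) = c U x with |c| = 1. The isometry
  property at x + ix gives |1 + c| = |1 + i|, which forces Re c = 0.\<close>

lemma U_imaginary:
  assumes x: "cinner x e = 0"
  shows "U (\<i> *\<^sub>C x) = \<i> *\<^sub>C U x \<or> U (\<i> *\<^sub>C x) = - \<i> *\<^sub>C U x"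
proof -
  have ix: "cinner (\<i> *\<^sub>C x) e = 0"
    using x by (simp add: cinner_scaleC_left)
  have "rank_one (U x) = rank_one (U (\<i> *\<^sub>C x))"
    using map_rank_one_U[OF x] map_rank_one_U[OF ix] by (simp add: rank_one_scaleC)
  then obtain c where c: "cmod c = 1" "U (\<i> *\<^sub>C x) = c *\<^sub>C U x"
    by (rule rank_one_eqD)
  show ?thesis
  proof (cases "x = 0")
    case True
    then show ?thesis
      using U_scaleR[OF x, of 0] by simp
  next
    case False
    have "U (x + \<i> *\<^sub>C x) = (1 + c) *\<^sub>C U x"
      by (simp add: U_add x ix c scaleC_add_left)
    moreover have "x + \<i> *\<^sub>C x = (1 + \<i>) *\<^sub>C x"
      by (simp add: scaleC_add_left)
    moreover have "norm (U (x + \<i> *\<^sub>C x)) = norm (x + \<i> *\<^sub>C x)"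
      using x ix by (intro U_plus(3)) (simp add: cinner_add_left)
    ultimately have "cmod (1 + c) = cmod (1 + \<i>)"
      using False by (simp add: norm_scaleC U_plus(3)[OF x])
    then have "(cmod (1 + c))\<^sup>2 = (cmod (1 + \<i>))\<^sup>2"
      by simp
    moreover have "(Re c)\<^sup>2 + (Im c)\<^sup>2 = 1"
      using c(1) by (simp flip: cmod_power2)
    ultimately have "Re c = 0"
      by (simp add: cmod_power2 power2_sum)
    with \<open>(Re c)\<^sup>2 + (Im c)\<^sup>2 = 1\<close> have "(Im c)\<^sup>2 = 1"
      by simp
    with \<open>Re c = 0\<close> have "c = \<i> \<or> c = - \<i>"
      by (auto simp: complex_eq_iff power2_eq_1_iff)
    then show ?thesis
      using c(2) by auto
  qed
qed

text \<open>The solution sets of the two alternatives are additive subgroups covering the orthogonal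
  complement of \<open>e\<close>, and a group is not the union of two proper subgroups.\<close>

lemma U_scaleC:
  obtains \<kappa> where "\<kappa> = (\<lambda>c. c) \<or> \<kappa> = cnj" "\<And>c x. cinner x e = 0 \<Longrightarrow> U (c *\<^sub>C x) = \<kappa> c *\<^sub>C U x"
proof -
  have ext: "U (c *\<^sub>C x) = Re c *\<^sub>R U x + Im c *\<^sub>R U (\<i> *\<^sub>C x)" if x: "cinner x e = 0" for c x
  proof -
    have "c *\<^sub>C x = Re c *\<^sub>R x + Im c *\<^sub>R \<i> *\<^sub>C x"
      by (subst complex_eq[of c]) (simp add: scaleR_scaleC scaleC_add_left scaleC_scaleC mult.commute)
    then show ?thesis
      using x by (simp add: U_add U_scaleR cinner_simps)
  qed
  have "(\<forall>x. cinner x e = 0 \<longrightarrow> U (\<i> *\<^sub>C x) = \<i> *\<^sub>C U x) \<or> (\<forall>x. cinner x e = 0 \<longrightarrow> U (\<i> *\<^sub>C x) = - \<i> *\<^sub>C U x)"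
  proof (rule ccontr)
    assume "\<not> ?thesis"
    then obtain x y where x: "cinner x e = 0" "U (\<i> *\<^sub>C x) \<noteq> \<i> *\<^sub>C U x"
      and y: "cinner y e = 0" "U (\<i> *\<^sub>C y) \<noteq> - \<i> *\<^sub>C U y"
      by blast
    have ix: "U (\<i> *\<^sub>C x) = - (\<i> *\<^sub>C U x)" and iy: "U (\<i> *\<^sub>C y) = \<i> *\<^sub>C U y"
      using U_imaginary[OF x(1)] U_imaginary[OF y(1)] x y by (auto simp: scaleC_minus_left)
    have sum: "U (\<i> *\<^sub>C (x + y)) = \<i> *\<^sub>C U y - \<i> *\<^sub>C U x"
      using x y by (simp add: scaleC_add_right U_add cinner_scaleC_left ix iy)
    have "cinner (x + y) e = 0"
      using x y by (simp add: cinner_add_left)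
    from U_imaginary[OF this] have "\<i> *\<^sub>C U x = - (\<i> *\<^sub>C U x) \<or> \<i> *\<^sub>C U y = - (\<i> *\<^sub>C U y)"
      unfolding sum U_add[OF x(1) y(1)] by (auto simp: scaleC_add_right scaleC_minus_left eq_neg_iff_add_eq_0
          algebra_simps)
    then show False
      using x(2) y(2) unfolding ix iy scaleC_minus_left by metis
  qed
  then show ?thesis
  proof
    assume *: "\<forall>x. cinner x e = 0 \<longrightarrow> U (\<i> *\<^sub>C x) = \<i> *\<^sub>C U x"
    show ?thesis
    proof (rule that[of "\<lambda>c. c"])
      show "U (c *\<^sub>C x) = c *\<^sub>C U x" if x: "cinner x e = 0" for c x
      proof -
        have "U (c *\<^sub>C x) = (complex_of_real (Re c) + \<i> * complex_of_real (Im c)) *\<^sub>C U x"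
          using * x ext[OF x, of c]
          by (simp add: scaleR_scaleC scaleC_add_left scaleC_scaleC mult.commute)
        then show ?thesis
          by (simp only: complex_eq[symmetric])
      qed
    qed simp
  next
    assume *: "\<forall>x. cinner x e = 0 \<longrightarrow> U (\<i> *\<^sub>C x) = - \<i> *\<^sub>C U x"
    show ?thesis
    proof (rule that[of cnj])
      show "U (c *\<^sub>C x) = cnj c *\<^sub>C U x" if x: "cinner x e = 0" for c x
      proof -
        have "U (c *\<^sub>C x) = (complex_of_real (Re c) + \<i> * complex_of_real (- Im c)) *\<^sub>C U x"
          using * x ext[OF x, of c]
          by (simp add: scaleR_scaleC scaleC_diff_left scaleC_scaleC scaleC_minus_left scaleC_minus_right mult.commute)
        also have "complex_of_real (Re c) + \<i> * complex_of_real (- Im c) = cnj c"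
          by (simp add: complex_eq_iff)
        finally show ?thesis .
      qed
    qed simp
  qed
qed

lemma implementing_isometry:
  obtains \<kappa> T where "\<kappa> = (\<lambda>c. c) \<or> \<kappa> = cnj" "\<And>x y. T (x + y) = T x + T y"
    "\<And>c x. T (c *\<^sub>C x) = \<kappa> c *\<^sub>C T x" "\<And>x. norm (T x) = norm x"
    "\<And>x. \<phi> (rank_one x) = rank_one (T x)" "surj T"
proof -
  obtain \<kappa> where \<kappa>: "\<kappa> = (\<lambda>c. c) \<or> \<kappa> = cnj" and U: "\<And>c x. cinner x e = 0 \<Longrightarrow> U (c *\<^sub>C x) = \<kappa> c *\<^sub>C U x"
    by (rule U_scaleC) blast
  have \<kappa>_simps: "\<kappa> (a + b) = \<kappa> a + \<kappa> b" "\<kappa> (a * b) = \<kappa> a * \<kappa> b" "\<kappa> (complex_of_real s) = complex_of_real s"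
    "\<kappa> (\<kappa> a) = a" "cmod (\<kappa> a) = cmod a" for a b s
    using \<kappa> by auto
  define p where "p v = v - cinner v e *\<^sub>C e" for v
  \<comment> \<open>The coefficient of f passes through \<kappa> so that T has the same homogeneity
    as \<open>U\<close>.\<close>
  define T where "T v = \<kappa> (cinner v e) *\<^sub>C f + U (p v)" for v
  have p: "cinner (p v) e = 0" for v
    by (simp add: p_def cinner_simps)
  have add: "T (x + y) = T x + T y" for x y
  proof -
    have "p (x + y) = p x + p y"
      by (simp add: p_def cinner_simps scaleC_add_left)
    then show ?thesis
      by (simp add: T_def U_add p \<kappa>_simps cinner_add_left scaleC_add_left)
  qed
  have scale: "T (c *\<^sub>C x) = \<kappa> c *\<^sub>C T x" for c x
  proof -
    have "p (c *\<^sub>C x) = c *\<^sub>C p x"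
      by (simp add: p_def cinner_simps scaleC_diff_right scaleC_scaleC)
    then show ?thesis
      by (simp add: T_def U p \<kappa>_simps cinner_scaleC_left scaleC_add_right scaleC_scaleC)
  qed
  have norm_T: "norm (T x) = norm x" for x
  proof -
    have 1: "(norm (T x))\<^sup>2 = (cmod (cinner x e))\<^sup>2 + (norm (p x))\<^sup>2"
      using Re_cinner_commute[of f "U (p x)"] Re_cinner_self
      by (simp add: T_def norm_add_sq norm_scaleC \<kappa>_simps f U_plus(3)[OF p] cinner_scaleC_left
          cinner_commute[of f "U (p x)"] U_plus(2)[OF p])
    also have "\<dots> = (norm x)\<^sup>2"
      using norm_diff_proj_sq[OF e, of x] by (simp add: p_def)
    finally show ?thesis
      by simp
  qed
  have implements: "\<phi> (rank_one x) = rank_one (T x)" for x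
  proof -
    define \<alpha> where "\<alpha> = cinner x e"
    \<comment> \<open>A phase c is split off so that y = cnj c x has a nonnegative real coefficient
      at e, the case settled by \<open>map_rank_one_real\<close>; rank-one operators ignore the
      phase.\<close>
    obtain c where c: "cmod c = 1" "\<alpha> = c * complex_of_real (cmod \<alpha>)"
    proof (cases "\<alpha> = 0")
      case True
      then show ?thesis
        using that[of 1] by simp
    next
      case False
      then show ?thesis
        using that[of "\<alpha> / complex_of_real (cmod \<alpha>)"] by (simp add: norm_divide)
    qed
    have "c * cnj c = 1"
      using c(1) by (simp add: complex_norm_square[symmetric])
    define y where "y = cnj c *\<^sub>C x"
    have x: "x = c *\<^sub>C y"
      by (simp add: y_def scaleC_scaleC \<open>c * cnj c = 1\<close>)
    have "cinner y e = cnj c * \<alpha>"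
      by (simp add: y_def \<alpha>_def cinner_scaleC_left)
    also have "\<dots> = complex_of_real (cmod \<alpha>)"
      using \<open>c * cnj c = 1\<close> by (subst c(2)) (simp add: mult.commute[of c] flip: mult.assoc)
    finally have ye: "cinner y e = complex_of_real (cmod \<alpha>)" .
    have "\<phi> (rank_one y) = \<phi> (rank_one (cmod \<alpha> *\<^sub>R e + p y))"
      by (simp add: p_def ye scaleC_of_real)
    also have "\<dots> = rank_one (T y)"
      by (simp add: map_rank_one_real p T_def ye \<kappa>_simps scaleC_of_real)
    finally show ?thesis
      by (simp add: x scale rank_one_scaleC c \<kappa>_simps)
  qed
  have "surj T"
    unfolding surj_def
  proof
    fix y
    show "\<exists>x. y = T x"
    proof (cases "y = 0")
      case True
      then show ?thesis
        using norm_T[of 0] by (intro exI[of _ 0]) simp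
    next
      case False
      define h where "h = (1 / norm y) *\<^sub>R y"
      have h: "norm h = 1" and y: "y = complex_of_real (norm y) *\<^sub>C h"
        using False by (simp_all add: h_def scaleC_of_real)
      \<comment> \<open>Surjectivity is inherited from that of \<phi> on rank-one projections: T v
        can differ from h only by a phase.\<close>
      obtain v where "\<phi> (rank_one v) = rank_one h"
        using surj_rank_one_unit[OF h] by metis
      then have "rank_one (T v) = rank_one h"
        by (simp add: implements)
      then obtain c where "h = c *\<^sub>C T v"
        by (rule rank_one_eqD)
      then have "y = T (\<kappa> (complex_of_real (norm y) * c) *\<^sub>C v)"
        using y by (simp add: scale \<kappa>_simps scaleC_scaleC)
      then show ?thesis
        by metis
    qed
  qed
  then show ?thesis
    using that[OF \<kappa> add scale norm_T implements] by blast
qed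

end

text \<open>Real polarization preserves Re <x, y>; Im <x, y> = Re <x, iy> then recovers the
  imaginary part, with a sign change when \<kappa> is conjugation.\<close>

lemma semilinear_isometry_cinner:
  fixes T :: "'a :: complex_hilbert \<Rightarrow> 'a"
  assumes \<kappa>: "\<kappa> = (\<lambda>c. c) \<or> \<kappa> = cnj" and add: "\<And>x y. T (x + y) = T x + T y"
    and scale: "\<And>c x. T (c *\<^sub>C x) = \<kappa> c *\<^sub>C T x" and norm_T: "\<And>x. norm (T x) = norm x"
  shows "cinner (T x) (T y) = \<kappa> (cinner x y)"
proof -
  have Re: "Re (cinner (T x) (T y)) = Re (cinner x y)" for x y
    using norm_add_sq[of "T x" "T y"] norm_add_sq[of x y] by (simp add: norm_T flip: add)
  have Im: "Im (cinner u v) = Re (cinner u (\<i> *\<^sub>C v))" for u v :: 'a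
    by (simp add: cinner_scaleC_right)
  have "Im (cinner x y) = Re (cinner (T x) (\<kappa> \<i> *\<^sub>C T y))"
    unfolding Im by (simp add: Re flip: scale)
  then have "Im (cinner (T x) (T y)) = Im (\<kappa> (cinner x y))"
    using \<kappa> by (auto simp: cinner_scaleC_right)
  moreover have "Re (cinner (T x) (T y)) = Re (\<kappa> (cinner x y))"
    using \<kappa> Re[of x y] by auto
  ultimately show ?thesis
    by (simp add: complex_eq_iff)
qed

theorem theorem1p2:
  fixes \<phi> :: "('a :: complex_hilbert \<Rightarrow>\<^sub>L 'a) \<Rightarrow> ('a \<Rightarrow>\<^sub>L 'a)"
    and r :: rat
  assumes "r > 1"
    and "\<phi> ` selfadjoint_ops = selfadjoint_ops"
    and "\<And>A B. A \<in> rank_one_projections \<union> {id_blinfun} \<Longrightarrow> B \<in> selfadjoint_ops \<Longrightarrow>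
      op_spectrum (op_powr (op_abs A) (real_of_rat r) o\<^sub>L B) =
      op_spectrum (op_powr (op_abs (\<phi> A)) (real_of_rat r) o\<^sub>L \<phi> B)"
  shows "\<exists>T :: 'a \<Rightarrow>\<^sub>L 'a. bij (blinfun_apply T) \<and>
    (clinear_op T \<and> blinfun_apply (op_adjoint T) = inv (blinfun_apply T) \<and>
       (\<forall>A \<in> selfadjoint_ops. \<phi> A = T o\<^sub>L A o\<^sub>L op_adjoint T) \<or>
     conjlinear_op T \<and> blinfun_apply (conj_adjoint T) = inv (blinfun_apply T) \<and>
       (\<forall>A \<in> selfadjoint_ops. \<phi> A = T o\<^sub>L A o\<^sub>L conj_adjoint T))"
proof -
  interpret spectrum_preserver \<phi> "real_of_rat r"
    using assms by unfold_locales auto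
  show ?thesis
  proof (cases "\<exists>v :: 'a. v \<noteq> 0")
    case False
    \<comment> \<open>The zero space has no unit vector e to start from; there the identity serves
      as T.\<close>
    then have trivial: "x = y" for x y :: 'a
      by (metis (full_types))
    then have "A = B" for A B :: "'a \<Rightarrow>\<^sub>L 'a"
      by (intro blinfun_eqI) blast
    moreover have "bij (blinfun_apply (id_blinfun :: 'a \<Rightarrow>\<^sub>L 'a))"
      by (simp add: id_def[symmetric])
    moreover have "blinfun_apply (op_adjoint (id_blinfun :: 'a \<Rightarrow>\<^sub>L 'a)) = inv (blinfun_apply id_blinfun)"
      by (rule ext) (rule trivial)
    ultimately show ?thesis
      using clinear_op_id by blast
  next
    case True
    then obtain v :: 'a where v: "v \<noteq> 0"
      by blast
    define e where "e = (1 / norm v) *\<^sub>R v"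
    have e: "norm e = 1"
      using v by (simp add: e_def)
    obtain f where f: "norm f = 1" "\<phi> (rank_one e) = rank_one f"
      by (rule map_rank_one_unit[OF e])
    interpret spectrum_preserver_pair \<phi> "real_of_rat r" e f
      using e f by unfold_locales
    obtain \<kappa> T where \<kappa>: "\<kappa> = (\<lambda>c. c) \<or> \<kappa> = cnj" and add: "\<And>x y. T (x + y) = T x + T y"
      and scale: "\<And>c x. T (c *\<^sub>C x) = \<kappa> c *\<^sub>C T x" and norm_T: "\<And>x. norm (T x) = norm x"
      and implements: "\<And>x. \<phi> (rank_one x) = rank_one (T x)" and surj: "surj T"
      by (rule implementing_isometry) blast
    have \<kappa>_simps: "\<kappa> (complex_of_real s) = complex_of_real s" "\<kappa> (\<kappa> a) = a" "Re (\<kappa> a) = Re a" for s a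
      using \<kappa> by auto
    have bl: "bounded_linear T"
      by (rule bounded_linear_intro[where K = 1])
        (simp_all add: add norm_T scaleR_scaleC scale \<kappa>_simps)
    have inj: "inj T"
    proof (rule injI)
      fix x y assume "T x = T y"
      then have "norm (T (x - y)) = 0"
        by (simp add: linear_simps[OF bl])
      then show "x = y"
        by (simp add: norm_T)
    qed
    define S where "S = inv T"
    have TS: "T (S x) = x" and ST: "S (T x) = x" for x
      by (simp_all add: S_def surj surj_f_inv_f inj)
    have S_add: "S (x + y) = S x + S y" for x y
      by (rule injD[OF inj]) (simp add: TS add)
    have S_scale: "S (c *\<^sub>C x) = \<kappa> c *\<^sub>C S x" for c x
      by (rule injD[OF inj]) (simp add: TS scale \<kappa>_simps)
    have S_norm: "norm (S x) = norm x" for x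
      using norm_T[of "S x"] by (simp add: TS)
    have bl': "bounded_linear S"
      by (rule bounded_linear_intro[where K = 1])
        (simp_all add: S_add S_norm scaleR_scaleC S_scale \<kappa>_simps)
    define T' where "T' = Blinfun T"
    define S' where "S' = Blinfun S"
    have T': "blinfun_apply T' = T" and S': "blinfun_apply S' = S"
      by (simp_all add: T'_def S'_def bounded_linear_Blinfun_apply bl bl')
    \<comment> \<open>According to \<kappa>, this says that S, the inverse of T, is the linear or
      the conjugate linear adjoint of T.\<close>
    have cinner_TS: "cinner (T x) y = \<kappa> (cinner x (S y))" for x y
      using semilinear_isometry_cinner[OF \<kappa> add scale norm_T, of x "S y"] by (simp add: TS)
    have conj: "\<phi> A = T' o\<^sub>L A o\<^sub>L S'" if A: "A \<in> selfadjoint_ops" for A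
    proof (rule selfadjoint_eqI[OF selfadjoint_map[OF A]])
      have "cinner (T (A (S x))) y = cinner x (T (A (S y)))" for x y
      proof -
        have "cinner (T (A (S x))) y = \<kappa> (cinner (S x) (A (S y)))"
          by (simp add: cinner_TS selfadjointD[OF A])
        also have "\<dots> = cinner (T (S x)) (T (A (S y)))"
          by (simp only: cinner_TS ST)
        finally show ?thesis
          by (simp only: TS)
      qed
      moreover have "clinear_op (T' o\<^sub>L A o\<^sub>L S')"
        by (simp add: clinear_op_def T' S' S_scale clinear_opD[OF selfadjoint_clinear[OF A]] scale \<kappa>_simps)
      ultimately show "T' o\<^sub>L A o\<^sub>L S' \<in> selfadjoint_ops"
        by (simp add: selfadjoint_ops_def T' S')
      fix h :: 'a
      \<comment> \<open>Every h has the form T v with v = S h, and \<open>cinner_map\<close>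
        compares the form of \<phi>(A) at T v with that of A at v.\<close>
      have "cinner (\<phi> A (T (S h))) (T (S h)) = cinner (A (S h)) (S h)"
        by (rule cinner_map[OF implements A])
      then show "Re (cinner (\<phi> A h) h) = Re (cinner ((T' o\<^sub>L A o\<^sub>L S') h) h)"
        by (simp add: T' S' TS cinner_TS \<kappa>_simps)
    qed
    have bij: "bij (blinfun_apply T')"
      by (simp add: T' bij_def inj surj)
    from \<kappa> show ?thesis
    proof
      assume \<kappa>: "\<kappa> = (\<lambda>c. c)"
      have "op_adjoint T' = S'"
        by (rule op_adjoint_eqI) (simp add: T' S' cinner_TS \<kappa>)
      moreover have "clinear_op T'"
        by (simp add: clinear_op_def T' scale \<kappa>)
      ultimately show ?thesis
        using bij conj by (intro exI[of _ T']) (simp add: T' S' S_def)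
    next
      assume \<kappa>: "\<kappa> = cnj"
      have "conj_adjoint T' = S'"
        by (rule conj_adjoint_eqI) (simp add: T' S' cinner_TS \<kappa> flip: cinner_commute)
      moreover have "conjlinear_op T'"
        by (simp add: conjlinear_op_def T' scale \<kappa>)
      ultimately show ?thesis
        using bij conj by (intro exI[of _ T']) (simp add: T' S' S_def)
    qed
  qed
qed

end
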